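(* The problem COL-PERI-SUM can be solved to optimality in $\mathcal{O}(n \log n)$ time. That is, there is an algorithm which, given $n \geq 1$, $L_1, L_2 > 0$ and areas $a_1,\dots,a_n > 0$ with $\sum_{i=1}^n a_i = L_1 L_2$, outputs in $\mathcal{O}(n\log n)$ time a partition $\{S_1,\dots,S_m\}$ of $\{1,\dots,n\}$ minimizing $\Phi_1$ over all partitions of $\{1,\dots,n\}$ into nonempty subsets ($m$ being free). Moreover, the problem can be solved in $\mathcal{O}(n)$ time if the rectangles are given in the input ordered by non-decreasing (or non-increasing) area.
   Context: COL-PERI-SUM: a rectangular region of length $L_1$ and height $L_2$ must be partitioned by two-stage guillotine cuts (first horizontal cuts of the whole region into layers, then vertical cuts of each layer) into $n$ rectangles of prescribed positive areas $a_1,\dots,a_n$ with $\sum_{i=1}^n a_i = L_1 L_2$, so as to minimize the sum of the perimeters of the rectangles. A solution is described by a partition $\{S_1,\dots,S_m\}$ of $\{1,\dots,n\}$ into nonempty layers ($m$ is not fixed). The height of layer $S_k$ is $w(S_k) = \frac{1}{L_1}\sum_{i\in S_k} a_i$, and rectangle $i \in S_k$ has height $w(S_k)$ and length $a_i / w(S_k)$. The objective to be minimized is $$\Phi_1 = 2\sum_{k=1}^m \sum_{i\in S_k}\left(w(S_k) + \frac{a_i}{w(S_k)}\right) = 2\sum_{k=1}^m\left(|S_k|\, w(S_k) + L_1\right).$$ Running time counts elementary operations, each arithmetic operation or comparison on the numbers involved having unit cost. *)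

theory Defs
  imports Complex_Main "HOL-Library.Disjoint_Sets" "HOL-Library.Landau_Symbols"
begin

section \<open>Model of computation\<close>

text \<open>
  Running time is counted for programs in a small first-order language with exact real arithmetic.
  Values are real numbers and immutable binary trees built from cons cells.  Programs are finite
  syntactic objects, so one program has to handle inputs of every size.  Every evaluated node of
  an expression has cost 1: each arithmetic operation, comparison, variable access, construction or
  inspection of a cell, and function call is an elementary operation (a real RAM with pointers
  performs each of them in constant time, the constant depending on the program only).  There is no
  rounding operation and no comparison of composite values, and program texts contain integer
  literals only, so that no information can be hidden in real constants.
\<close>

datatype val = VNum real | VNil | VCons val val

datatype arith = Plus | Minus | Times | Divide

datatype expr =
    Var nat                        \<comment> \<open>de Bruijn index into the environment\<close>
  | Lit int
  | Arith arith expr expr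
  | EmptyList
  | Pair expr expr
  | LetIn expr expr                \<comment> \<open>the bound value becomes variable 0 of the body\<close>
  | IfLess expr expr expr expr     \<comment> \<open>if the first number is less than the second then ... else ...\<close>
  | Match expr expr expr           \<comment> \<open>empty branch; cell branch, with head as 0 and tail as 1\<close>
  | Call nat "expr list"

text \<open>A program is the list of the bodies of its (mutually recursive) functions; the arguments of a
  call are the variables 0, 1, ... of the body. Function 0 is the entry point.\<close>

type_synonym program = "expr list"

fun arith_op :: "arith \<Rightarrow> real \<Rightarrow> real \<Rightarrow> real" where
  "arith_op Plus x y = x + y"
| "arith_op Minus x y = x - y"
| "arith_op Times x y = x * y"
| "arith_op Divide x y = x / y"

text \<open>\<open>evaluates p env e v t\<close>: in environment \<open>env\<close>, the expression \<open>e\<close> evaluates to \<open>v\<close>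
  at cost \<open>t\<close>.  Erroneous evaluations (unbound variables, operations on values of the wrong
  shape, division by zero) and nonterminating ones have no derivation.\<close>

inductive evaluates :: "program \<Rightarrow> val list \<Rightarrow> expr \<Rightarrow> val \<Rightarrow> nat \<Rightarrow> bool"
  and evaluates_list :: "program \<Rightarrow> val list \<Rightarrow> expr list \<Rightarrow> val list \<Rightarrow> nat \<Rightarrow> bool"
  for p :: program
where
  Var: "i < length env \<Longrightarrow> evaluates p env (Var i) (env ! i) 1"
| Lit: "evaluates p env (Lit k) (VNum (of_int k)) 1"
| Arith: "evaluates p env e1 (VNum x) t1 \<Longrightarrow> evaluates p env e2 (VNum y) t2 \<Longrightarrow>
    f = Divide \<longrightarrow> y \<noteq> 0 \<Longrightarrow>
    evaluates p env (Arith f e1 e2) (VNum (arith_op f x y)) (1 + t1 + t2)"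
| EmptyList: "evaluates p env EmptyList VNil 1"
| Pair: "evaluates p env e1 v1 t1 \<Longrightarrow> evaluates p env e2 v2 t2 \<Longrightarrow>
    evaluates p env (Pair e1 e2) (VCons v1 v2) (1 + t1 + t2)"
| LetIn: "evaluates p env e1 v1 t1 \<Longrightarrow> evaluates p (v1 # env) e2 v2 t2 \<Longrightarrow>
    evaluates p env (LetIn e1 e2) v2 (1 + t1 + t2)"
| IfLess_True: "evaluates p env e1 (VNum x) t1 \<Longrightarrow> evaluates p env e2 (VNum y) t2 \<Longrightarrow> x < y \<Longrightarrow>
    evaluates p env e3 v t3 \<Longrightarrow>
    evaluates p env (IfLess e1 e2 e3 e4) v (1 + t1 + t2 + t3)"
| IfLess_False: "evaluates p env e1 (VNum x) t1 \<Longrightarrow> evaluates p env e2 (VNum y) t2 \<Longrightarrow> \<not> x < y \<Longrightarrow>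
    evaluates p env e4 v t4 \<Longrightarrow>
    evaluates p env (IfLess e1 e2 e3 e4) v (1 + t1 + t2 + t4)"
| Match_Nil: "evaluates p env e1 VNil t1 \<Longrightarrow> evaluates p env e2 v t2 \<Longrightarrow>
    evaluates p env (Match e1 e2 e3) v (1 + t1 + t2)"
| Match_Cons: "evaluates p env e1 (VCons h u) t1 \<Longrightarrow> evaluates p (h # u # env) e3 v t3 \<Longrightarrow>
    evaluates p env (Match e1 e2 e3) v (1 + t1 + t3)"
| Call: "evaluates_list p env es vs t1 \<Longrightarrow> j < length p \<Longrightarrow> evaluates p vs (p ! j) v t2 \<Longrightarrow>
    evaluates p env (Call j es) v (1 + t1 + t2)"
| Nil: "evaluates_list p env [] [] 0"
| Cons: "evaluates p env e v t1 \<Longrightarrow> evaluates_list p env es vs t2 \<Longrightarrow>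
    evaluates_list p env (e # es) (v # vs) (t1 + t2)"

inductive_cases evaluates_elims:
  "evaluates p env (Var i) v t" "evaluates p env (Lit k) v t"
  "evaluates p env (Arith f e1 e2) v t" "evaluates p env EmptyList v t"
  "evaluates p env (Pair e1 e2) v t" "evaluates p env (LetIn e1 e2) v t"
  "evaluates p env (IfLess e1 e2 e3 e4) v t" "evaluates p env (Match e1 e2 e3) v t"
  "evaluates p env (Call j es) v t"
inductive_cases evaluates_list_elims:
  "evaluates_list p env [] vs t" "evaluates_list p env (e # es) vs t"

lemma evaluates_deterministic:
  "evaluates p env e v t \<Longrightarrow> (\<forall>v' t'. evaluates p env e v' t' \<longrightarrow> v' = v \<and> t' = t)"
  "evaluates_list p env es vs t \<Longrightarrow>
     (\<forall>vs' t'. evaluates_list p env es vs' t' \<longrightarrow> vs' = vs \<and> t' = t)"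
proof (induction rule: evaluates_evaluates_list.inducts)
qed (intro allI impI, (erule evaluates_elims | erule evaluates_list_elims);
     (metis val.inject(1,2) val.distinct One_nat_def plus_1_eq_Suc add_Suc))+

definition runs :: "program \<Rightarrow> val list \<Rightarrow> val \<Rightarrow> nat \<Rightarrow> bool" where
  "runs p input v t \<longleftrightarrow> p \<noteq> [] \<and> evaluates p input (p ! 0) v t"

fun val_of_list :: "val list \<Rightarrow> val" where
  "val_of_list [] = VNil"
| "val_of_list (v # vs) = VCons v (val_of_list vs)"


section \<open>The problem COL-PERI-SUM\<close>

definition instance_ok :: "nat \<Rightarrow> real \<Rightarrow> real \<Rightarrow> (nat \<Rightarrow> real) \<Rightarrow> bool" where
  "instance_ok n L1 L2 a \<longleftrightarrow>
     1 \<le> n \<and> 0 < L1 \<and> 0 < L2 \<and> (\<forall>i\<in>{1..n}. 0 < a i) \<and> (\<Sum>i=1..n. a i) = L1 * L2"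

definition layer_height :: "real \<Rightarrow> (nat \<Rightarrow> real) \<Rightarrow> nat set \<Rightarrow> real" where
  "layer_height L1 a S = 1 / L1 * (\<Sum>i\<in>S. a i)"

definition perimeter_sum :: "real \<Rightarrow> (nat \<Rightarrow> real) \<Rightarrow> nat set set \<Rightarrow> real" where
  "perimeter_sum L1 a P =
     2 * (\<Sum>S\<in>P. \<Sum>i\<in>S. layer_height L1 a S + a i / layer_height L1 a S)"

lemma perimeter_sum_alt:
  assumes "instance_ok n L1 L2 a" "partition_on {1..n} P"
  shows "perimeter_sum L1 a P = 2 * (\<Sum>S\<in>P. real (card S) * layer_height L1 a S + L1)"
proof -
  have "(\<Sum>i\<in>S. layer_height L1 a S + a i / layer_height L1 a S)
      = real (card S) * layer_height L1 a S + L1" if "S \<in> P" for S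
  proof -
    have S: "S \<subseteq> {1..n}" "S \<noteq> {}"
      using assms(2) that by (auto simp: partition_on_def)
    then have "0 < (\<Sum>i\<in>S. a i)"
      using assms(1) by (intro sum_pos) (auto simp: instance_ok_def intro: finite_subset)
    then have "(\<Sum>i\<in>S. a i) / layer_height L1 a S = L1"
      by (simp add: layer_height_def)
    then show ?thesis
      by (simp add: sum.distrib flip: sum_divide_distrib)
  qed
  then show ?thesis
    by (simp add: perimeter_sum_def)
qed

definition optimal_layering :: "nat \<Rightarrow> real \<Rightarrow> (nat \<Rightarrow> real) \<Rightarrow> nat set set \<Rightarrow> bool" where
  "optimal_layering n L1 a P \<longleftrightarrow>
     partition_on {1..n} P \<and>
     (\<forall>Q. partition_on {1..n} Q \<longrightarrow> perimeter_sum L1 a P \<le> perimeter_sum L1 a Q)"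

definition encode_input :: "nat \<Rightarrow> real \<Rightarrow> real \<Rightarrow> (nat \<Rightarrow> real) \<Rightarrow> val list" where
  "encode_input n L1 L2 a = [VNum L1, VNum L2, val_of_list (map (\<lambda>i. VNum (a i)) [1..<Suc n])]"

text \<open>The output is a list of layers, each a list of indices, in any order and without
  repetitions.\<close>

definition represents :: "val \<Rightarrow> nat set set \<Rightarrow> bool" where
  "represents v P \<longleftrightarrow>
     (\<exists>Ss :: nat list list.
        v = val_of_list (map (\<lambda>S. val_of_list (map (\<lambda>i. VNum (real i)) S)) Ss) \<and>
        distinct (map set Ss) \<and> (\<forall>S\<in>set Ss. distinct S) \<and> P = set (map set Ss))"

text \<open>\<open>solves_within p R T\<close>: on every instance that satisfies the restriction \<open>R\<close>, the program
  \<open>p\<close> halts with an optimal solution after at most \<open>T n\<close> elementary operations.\<close>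

definition solves_within ::
    "program \<Rightarrow> (nat \<Rightarrow> (nat \<Rightarrow> real) \<Rightarrow> bool) \<Rightarrow> (nat \<Rightarrow> real) \<Rightarrow> bool" where
  "solves_within p R T \<longleftrightarrow>
     (\<forall>n L1 L2 a. instance_ok n L1 L2 a \<and> R n a \<longrightarrow>
        (\<exists>v t P. runs p (encode_input n L1 L2 a) v t \<and> real t \<le> T n \<and>
                 represents v P \<and> optimal_layering n L1 a P))"

end

theory Submission
  imports Defs "HOL-Library.Multiset"
begin

text \<open>
  Up to the factor \<open>2 / L1\<close>, a layer \<open>S\<close> costs its cardinality times its area plus the constant
  \<open>C = L1\<^sup>2\<close>. For items sorted by increasing area, some optimal layering consists of
  consecutive segments (larger items belong into smaller layers), so that the optimum is a least
  weight subsequence: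
  \<open>opt j = min {opt i + (j - i) (A j - A i) + C | i < j}\<close> for the prefix areas \<open>A\<close>. These weights
  satisfy the Monge inequality. Wilber's algorithm therefore finds the optimum in linear time:
  from the known values it guesses the next ones as column minima of a Monge matrix, computed by
  the SMAWK algorithm, and it checks the guesses by a second matrix whose rows are the guessed
  values. Both need sequential access only and thus run on lists. Unsorted inputs are sorted by
  merge sort first.
\<close>

section \<open>Symbolic execution\<close>

text \<open>The obstacle is that the recurrence is on-line: the rows of its matrix are the very
  values to be computed, whereas SMAWK wants its rows beforehand. A round therefore starts from
  known nodes at positions \<open>r..c\<close> and treats a block of columns after \<open>c\<close>.
  The guesses ignore layers starting inside the block. The second matrix accounts for these, but its
  guessed rows can be trusted only before the first wrong one; so guesses and challengers are
  compared from left to right, up to the first failure. Entries of the second matrix for starts at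
  or after the column need no infinite filler, because \<open>(j - i) * (A j - A i)\<close> is
  nonnegative and Monge for all \<open>i\<close> and \<open>j\<close>. The language has no arrays.
  Back pointers are replaced by a cut list in each node, sharing its tail with the predecessor's
  list; SMAWK keeps columns on its stack and compares row positions instead of indexing.\<close>

definition wp :: "program \<Rightarrow> val list \<Rightarrow> expr \<Rightarrow> (val \<Rightarrow> nat \<Rightarrow> bool) \<Rightarrow> bool" where
  "wp p env e Q \<longleftrightarrow> (\<exists>v t. evaluates p env e v t \<and> Q v t)"

definition wps :: "program \<Rightarrow> val list \<Rightarrow> expr list \<Rightarrow> (val list \<Rightarrow> nat \<Rightarrow> bool) \<Rightarrow> bool" where
  "wps p env es Q \<longleftrightarrow> (\<exists>vs t. evaluates_list p env es vs t \<and> Q vs t)"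

text \<open>Not unfolded by \<open>simp\<close>, so that symbolic execution halts at each call,
  where a \<open>returns\<close> fact supplies value and cost.\<close>

definition wp_call :: "program \<Rightarrow> nat \<Rightarrow> val list \<Rightarrow> (val \<Rightarrow> nat \<Rightarrow> bool) \<Rightarrow> bool" where
  "wp_call p j vs Q \<longleftrightarrow> j < length p \<and> wp p vs (p ! j) Q"

text \<open>The value is exact but the cost only bounded: generous round constants make the sums
  provable by \<open>simp\<close>.\<close>

definition returns :: "program \<Rightarrow> nat \<Rightarrow> val list \<Rightarrow> val \<Rightarrow> nat \<Rightarrow> bool" where
  "returns p j vs v n \<longleftrightarrow> wp_call p j vs (\<lambda>v' t. v' = v \<and> t \<le> n)"

inductive_simps evaluates_iffs:
  "evaluates p env (Var i) v t" "evaluates p env (Lit k) v t"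
  "evaluates p env (Arith f e1 e2) v t" "evaluates p env EmptyList v t"
  "evaluates p env (Pair e1 e2) v t" "evaluates p env (LetIn e1 e2) v t"
  "evaluates p env (IfLess e1 e2 e3 e4) v t" "evaluates p env (Match e1 e2 e3) v t"
  "evaluates p env (Call j es) v t"
  "evaluates_list p env [] vs t" "evaluates_list p env (e # es) vs t"

lemma wp_Var [simp]: "wp p env (Var i) Q \<longleftrightarrow> i < length env \<and> Q (env ! i) (Suc 0)"
  by (auto simp: wp_def evaluates_iffs)

lemma wp_Lit [simp]: "wp p env (Lit k) Q \<longleftrightarrow> Q (VNum (of_int k)) (Suc 0)"
  by (auto simp: wp_def evaluates_iffs)

lemma wp_EmptyList [simp]: "wp p env EmptyList Q \<longleftrightarrow> Q VNil (Suc 0)"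
  by (auto simp: wp_def evaluates_iffs)

lemma wp_Arith [simp]:
  "wp p env (Arith f e1 e2) Q \<longleftrightarrow>
     wp p env e1 (\<lambda>v1 t1. wp p env e2 (\<lambda>v2 t2.
       case v1 of VNum x \<Rightarrow> (case v2 of VNum y \<Rightarrow>
           (f = Divide \<longrightarrow> y \<noteq> 0) \<and> Q (VNum (arith_op f x y)) (Suc (t1 + t2))
         | _ \<Rightarrow> False) | _ \<Rightarrow> False))"
  unfolding wp_def evaluates_iffs
  apply (rule iffI; elim exE conjE)
   apply (intro exI conjI, assumption, assumption, simp)
  apply (simp split: val.splits)
  apply blast
  done

lemma wp_Pair [simp]:
  "wp p env (Pair e1 e2) Q \<longleftrightarrow>
     wp p env e1 (\<lambda>v1 t1. wp p env e2 (\<lambda>v2 t2. Q (VCons v1 v2) (Suc (t1 + t2))))"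
  unfolding wp_def evaluates_iffs by blast

lemma wp_LetIn [simp]:
  "wp p env (LetIn e1 e2) Q \<longleftrightarrow>
     wp p env e1 (\<lambda>v1 t1. wp p (v1 # env) e2 (\<lambda>v2 t2. Q v2 (Suc (t1 + t2))))"
  unfolding wp_def evaluates_iffs by blast

lemma wp_IfLess [simp]:
  "wp p env (IfLess e1 e2 e3 e4) Q \<longleftrightarrow>
     wp p env e1 (\<lambda>v1 t1. wp p env e2 (\<lambda>v2 t2.
       case v1 of VNum x \<Rightarrow> (case v2 of VNum y \<Rightarrow>
           wp p env (if x < y then e3 else e4) (\<lambda>v t. Q v (Suc (t1 + t2 + t)))
         | _ \<Rightarrow> False) | _ \<Rightarrow> False))"
  unfolding wp_def evaluates_iffs
  apply (rule iffI; elim exE conjE disjE)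
    apply (intro exI conjI, assumption, assumption, simp, blast)
   apply (intro exI conjI, assumption, assumption, simp, blast)
  apply (simp split: val.splits if_splits)
   apply blast
  apply blast
  done

lemma wp_Match [simp]:
  "wp p env (Match e1 e2 e3) Q \<longleftrightarrow>
     wp p env e1 (\<lambda>v t1. case v of VNum x \<Rightarrow> False
       | VNil \<Rightarrow> wp p env e2 (\<lambda>v t. Q v (Suc (t1 + t)))
       | VCons h u \<Rightarrow> wp p (h # u # env) e3 (\<lambda>v t. Q v (Suc (t1 + t))))"
  unfolding wp_def evaluates_iffs
  apply (rule iffI; elim exE conjE disjE)
    apply (intro exI conjI, assumption, simp, blast)
   apply (intro exI conjI, assumption, simp, blast)
  apply (simp split: val.splits)
   apply blast
  apply blast
  done

lemma wp_Call [simp]: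
  "wp p env (Call j es) Q \<longleftrightarrow>
     wps p env es (\<lambda>vs t1. wp_call p j vs (\<lambda>v t2. Q v (Suc (t1 + t2))))"
  unfolding wp_def wps_def wp_call_def evaluates_iffs by blast

lemma wps_Nil [simp]: "wps p env [] Q \<longleftrightarrow> Q [] 0"
  by (auto simp: wps_def evaluates_iffs)

lemma wps_Cons [simp]:
  "wps p env (e # es) Q \<longleftrightarrow>
     wp p env e (\<lambda>v t1. wps p env es (\<lambda>vs t2. Q (v # vs) (t1 + t2)))"
  unfolding wp_def wps_def evaluates_iffs by blast

lemma wp_call_returns:
  assumes "returns p j vs v n" "\<And>t. t \<le> n \<Longrightarrow> Q v t"
  shows "wp_call p j vs Q"
  using assms unfolding returns_def wp_call_def wp_def by blast


section \<open>The program\<close>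

text \<open>The argument \<open>e\<close> lies outside the scope of the two bound variables, so its
  indices are those of the surrounding environment. Cells used as pairs are taken apart by the same
  projections.\<close>

abbreviation (input) Hd :: "expr \<Rightarrow> expr" where "Hd e \<equiv> Match e EmptyList (Var 0)"
abbreviation (input) Tl :: "expr \<Rightarrow> expr" where "Tl e \<equiv> Match e EmptyList (Var 1)"
abbreviation (input) Third :: "expr \<Rightarrow> expr" where "Third e \<equiv> Hd (Tl (Tl e))"

abbreviation (input) "labels_fn \<equiv> 1 :: nat"
abbreviation (input) "revapp_fn \<equiv> 2 :: nat"
abbreviation (input) "columns_fn \<equiv> 3 :: nat"
abbreviation (input) "entry_fn \<equiv> 4 :: nat"
abbreviation (input) "reduce_fn \<equiv> 5 :: nat"
abbreviation (input) "unstack_fn \<equiv> 6 :: nat"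
abbreviation (input) "seconds_fn \<equiv> 7 :: nat"
abbreviation (input) "scan_fn \<equiv> 8 :: nat"
abbreviation (input) "interpolate_fn \<equiv> 9 :: nat"
abbreviation (input) "smawk_fn \<equiv> 10 :: nat"
abbreviation (input) "links_fn \<equiv> 11 :: nat"
abbreviation (input) "prefix_fn \<equiv> 12 :: nat"
abbreviation (input) "check_fn \<equiv> 13 :: nat"
abbreviation (input) "lws_fn \<equiv> 14 :: nat"
abbreviation (input) "emit_fn \<equiv> 15 :: nat"
abbreviation (input) "solve_fn \<equiv> 16 :: nat"
abbreviation (input) "split_fn \<equiv> 17 :: nat"
abbreviation (input) "merge_fn \<equiv> 18 :: nat"
abbreviation (input) "msort_fn \<equiv> 19 :: nat"

(* arguments: areas, label *)
definition labels_body :: expr where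
  "labels_body = Match (Var 0) EmptyList
     (Pair (Pair (Var 3) (Var 0)) (Call labels_fn [Var 1, Arith Plus (Var 3) (Lit 1)]))"

definition revapp_body :: expr where
  "revapp_body = Match (Var 0) (Var 1) (Call revapp_fn [Var 1, Pair (Var 0) (Var 3)])"

(* arguments: items, number and total area of the items before *)
definition columns_body :: expr where
  "columns_body = Match (Var 0) EmptyList
     (LetIn (Arith Plus (Var 3) (Lit 1)) (LetIn (Arith Plus (Var 5) (Tl (Var 1)))
       (Pair (Pair (Var 1) (Pair (Var 0) (Hd (Var 2)))) (Call columns_fn [Var 3, Var 1, Var 0]))))"

(* arguments: node, column *)
definition entry_body :: expr where
  "entry_body = Arith Plus (Third (Var 0))
     (Arith Times (Arith Minus (Hd (Var 1)) (Hd (Var 0)))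
        (Arith Minus (Hd (Tl (Var 1))) (Hd (Tl (Var 0)))))"

(* arguments: rows, stack of pairs (row, column), columns *)
definition reduce_body :: expr where
  "reduce_body = Match (Var 0) (Call unstack_fn [Var 1, EmptyList])
     (Match (Var 3)
        (Match (Var 4) EmptyList
           (Call reduce_fn [Var 3, Pair (Pair (Var 2) (Var 0)) EmptyList, Var 1]))
        (IfLess (Call entry_fn [Var 2, Tl (Var 0)]) (Call entry_fn [Hd (Var 0), Tl (Var 0)])
           (Call reduce_fn [Var 4, Var 1, Pair (Tl (Var 0)) (Var 6)])
           (Match (Var 6) (Call reduce_fn [Var 3, Var 5, Var 6])
              (Call reduce_fn [Var 5, Pair (Pair (Var 4) (Var 0)) (Var 7), Var 1]))))"

(* arguments: stack, rows *)
definition unstack_body :: expr where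
  "unstack_body = Match (Var 0) (Var 1) (Call unstack_fn [Var 1, Pair (Hd (Var 0)) (Var 3)])"

definition seconds_body :: expr where
  "seconds_body = Match (Var 0) EmptyList
     (Match (Var 1) EmptyList (Pair (Var 0) (Call seconds_fn [Var 1])))"

(* arguments: best row so far, rows, column, list whose head (if any) bounds the search *)
definition scan_body :: expr where
  "scan_body = Match (Var 1) (Pair (Var 0) EmptyList)
     (LetIn (IfLess (Call entry_fn [Var 0, Var 4]) (Call entry_fn [Var 2, Var 4]) (Var 0) (Var 2))
        (Match (Var 6) (Call scan_fn [Var 0, Var 2, Var 5, Var 6])
           (IfLess (Hd (Var 3)) (Hd (Var 0))
              (Call scan_fn [Var 2, Var 4, Var 7, Var 8]) (Pair (Var 2) (Var 6)))))"

(* arguments: rows, columns, minimal rows of every second column *)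
definition interpolate_body :: expr where
  "interpolate_body = Match (Var 1) EmptyList
     (LetIn (Call scan_fn [Hd (Var 2), Var 2, Var 0, Var 4])
        (Match (Var 5) (Pair (Hd (Var 0)) EmptyList)
           (Pair (Hd (Var 2)) (Pair (Var 0)
              (Call interpolate_fn [Tl (Var 2), Tl (Var 4), Var 1])))))"

(* arguments: rows, columns *)
definition smawk_body :: expr where
  "smawk_body = Match (Var 1) EmptyList
     (LetIn (Call reduce_fn [Var 2, EmptyList, Var 3])
        (Call interpolate_fn [Var 0, Var 4, Call smawk_fn [Var 0, Call seconds_fn [Var 4]]]))"

(* arguments: nodes, columns, penalty *)
definition links_body :: expr where
  "links_body = Match (Var 1) EmptyList (Match (Var 2) EmptyList
     (Pair
        (Pair (Hd (Var 2)) (Pair (Hd (Tl (Var 2)))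
           (Pair (Arith Plus (Call entry_fn [Var 0, Var 2]) (Var 6))
              (Pair (Hd (Var 0)) (Tl (Tl (Tl (Var 0))))))))
        (Call links_fn [Var 1, Var 3, Var 6])))"

(* arguments: rows, columns *)
definition prefix_body :: expr where
  "prefix_body = Match (Var 0) EmptyList (Match (Var 3) EmptyList
     (Pair (Var 0) (Call prefix_fn [Var 3, Var 1])))"

(* arguments: rows, tentative nodes, challengers, columns, reversed list of accepted nodes *)
definition check_body :: expr where
  "check_body = Match (Var 1)
     (Pair (Call revapp_fn [Call revapp_fn [Var 0, EmptyList], Call revapp_fn [Var 4, EmptyList]])
        (Var 3))
     (IfLess (Third (Hd (Var 4))) (Third (Var 0))
        (Pair (Call revapp_fn [Pair (Hd (Var 4)) (Var 6), EmptyList]) (Tl (Var 5)))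
        (Call check_fn [Var 2, Var 1, Tl (Var 4), Tl (Var 5), Pair (Var 0) (Var 6)]))"

(* arguments: rows, columns, penalty *)
definition lws_body :: expr where
  "lws_body = Match (Var 1) (Hd (Call revapp_fn [Var 0, EmptyList]))
     (LetIn (Call prefix_fn [Var 2, Var 3])
        (LetIn (Call links_fn [Call smawk_fn [Var 3, Var 0], Var 0, Var 5])
           (LetIn (Call check_fn [Var 4, Var 0,
                     Call links_fn [Call smawk_fn [Var 0, Var 1], Var 1, Var 6], Var 5, EmptyList])
              (Call lws_fn [Hd (Var 0), Tl (Var 0), Var 7]))))"

(* arguments: cuts and columns in decreasing order, labels of the current layer *)
definition emit_body :: expr where
  "emit_body = Match (Var 1) EmptyList
     (IfLess (Arith Plus (Hd (Var 2)) (Lit 1)) (Hd (Var 0))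
        (Call emit_fn [Var 2, Var 1, Pair (Tl (Tl (Var 0))) (Var 4)])
        (Pair (Pair (Tl (Tl (Var 0))) (Var 4)) (Call emit_fn [Tl (Var 2), Var 1, EmptyList])))"

(* arguments: L1, items in increasing order of area *)
definition solve_body :: expr where
  "solve_body = LetIn (Call columns_fn [Var 1, Lit 0, Lit 0])
     (Call emit_fn
       [Tl (Tl (Tl (Call lws_fn
          [Pair (Pair (Lit 0) (Pair (Lit 0) (Pair (Lit 0) EmptyList))) EmptyList,
           Var 0, Arith Times (Var 1) (Var 1)]))),
        Call revapp_fn [Var 0, EmptyList], EmptyList])"

definition split_body :: expr where
  "split_body = Match (Var 0) (Pair EmptyList EmptyList)
     (LetIn (Call split_fn [Var 1]) (Pair (Pair (Var 1) (Tl (Var 0))) (Hd (Var 0))))"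

definition merge_body :: expr where
  "merge_body = Match (Var 0) (Var 1) (Match (Var 3) (Var 2)
     (IfLess (Tl (Var 0)) (Tl (Var 2))
        (Pair (Var 0) (Call merge_fn [Var 4, Var 1]))
        (Pair (Var 2) (Call merge_fn [Var 3, Var 5]))))"

definition msort_body :: expr where
  "msort_body = Match (Var 0) EmptyList (Match (Var 1) (Var 2)
     (LetIn (Call split_fn [Var 4])
        (Call merge_fn [Call msort_fn [Hd (Var 0)], Call msort_fn [Tl (Var 0)]])))"

text \<open>With the entry point as a parameter, the two programs share all routines, and each
  routine is verified once for every \<open>m\<close>. The function numbers above are positions in
  this list.\<close>

definition prog :: "expr \<Rightarrow> program" where
  "prog main = [main, labels_body, revapp_body, columns_body, entry_body, reduce_body, unstack_body,
     seconds_body, scan_body, interpolate_body, smawk_body, links_body, prefix_body, check_body,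
     lws_body, emit_body, solve_body, split_body, merge_body, msort_body]"

lemma wp_call_prog:
  "wp_call (prog m) labels_fn vs Q \<longleftrightarrow> wp (prog m) vs labels_body Q"
  "wp_call (prog m) revapp_fn vs Q \<longleftrightarrow> wp (prog m) vs revapp_body Q"
  "wp_call (prog m) columns_fn vs Q \<longleftrightarrow> wp (prog m) vs columns_body Q"
  "wp_call (prog m) entry_fn vs Q \<longleftrightarrow> wp (prog m) vs entry_body Q"
  "wp_call (prog m) reduce_fn vs Q \<longleftrightarrow> wp (prog m) vs reduce_body Q"
  "wp_call (prog m) unstack_fn vs Q \<longleftrightarrow> wp (prog m) vs unstack_body Q"
  "wp_call (prog m) seconds_fn vs Q \<longleftrightarrow> wp (prog m) vs seconds_body Q"
  "wp_call (prog m) scan_fn vs Q \<longleftrightarrow> wp (prog m) vs scan_body Q"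
  "wp_call (prog m) interpolate_fn vs Q \<longleftrightarrow> wp (prog m) vs interpolate_body Q"
  "wp_call (prog m) smawk_fn vs Q \<longleftrightarrow> wp (prog m) vs smawk_body Q"
  "wp_call (prog m) links_fn vs Q \<longleftrightarrow> wp (prog m) vs links_body Q"
  "wp_call (prog m) prefix_fn vs Q \<longleftrightarrow> wp (prog m) vs prefix_body Q"
  "wp_call (prog m) check_fn vs Q \<longleftrightarrow> wp (prog m) vs check_body Q"
  "wp_call (prog m) lws_fn vs Q \<longleftrightarrow> wp (prog m) vs lws_body Q"
  "wp_call (prog m) emit_fn vs Q \<longleftrightarrow> wp (prog m) vs emit_body Q"
  "wp_call (prog m) solve_fn vs Q \<longleftrightarrow> wp (prog m) vs solve_body Q"
  "wp_call (prog m) split_fn vs Q \<longleftrightarrow> wp (prog m) vs split_body Q"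
  "wp_call (prog m) merge_fn vs Q \<longleftrightarrow> wp (prog m) vs merge_body Q"
  "wp_call (prog m) msort_fn vs Q \<longleftrightarrow> wp (prog m) vs msort_body Q"
  by (simp_all add: wp_call_def prog_def)


section \<open>The simple routines\<close>

text \<open>A node \<open>(j, A, F, cuts)\<close> stands for a layering of the first \<open>j\<close> items, of total area \<open>A\<close>,
  with objective value \<open>F\<close> and last positions of the earlier layers in \<open>cuts\<close>. A column
  \<open>(j, A, l)\<close> is a position to be reached, \<open>l\<close> being the label of the \<open>j\<close>-th item.\<close>

type_synonym node = "real \<times> real \<times> real \<times> real list"
type_synonym col = "real \<times> real \<times> nat"

abbreviation pos :: "real \<times> 'a \<Rightarrow> real" where "pos x \<equiv> fst x"
abbreviation area :: "real \<times> real \<times> 'a \<Rightarrow> real" where "area x \<equiv> fst (snd x)"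
abbreviation cost :: "node \<Rightarrow> real" where "cost x \<equiv> fst (snd (snd x))"
abbreviation cuts :: "node \<Rightarrow> real list" where "cuts x \<equiv> snd (snd (snd x))"

abbreviation enc_list :: "('a \<Rightarrow> val) \<Rightarrow> 'a list \<Rightarrow> val" where
  "enc_list f xs \<equiv> val_of_list (map f xs)"

definition enc_node :: "node \<Rightarrow> val" where
  "enc_node x = VCons (VNum (pos x)) (VCons (VNum (area x))
     (VCons (VNum (cost x)) (enc_list VNum (cuts x))))"

definition enc_col :: "col \<Rightarrow> val" where
  "enc_col c = VCons (VNum (pos c)) (VCons (VNum (area c)) (VNum (real (snd (snd c)))))"

definition enc_entry :: "node \<times> col \<Rightarrow> val" where
  "enc_entry z = VCons (enc_node (fst z)) (enc_col (snd z))"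

definition enc_item :: "(nat \<Rightarrow> real) \<Rightarrow> nat \<Rightarrow> val" where
  "enc_item a i = VCons (VNum (real i)) (VNum (a i))"

lemma case_enc [simp]:
  "case_val f1 f2 f3 (enc_node x) = f3 (VNum (pos x)) (VCons (VNum (area x))
     (VCons (VNum (cost x)) (enc_list VNum (cuts x))))"
  "case_val f1 f2 f3 (enc_col c) =
     f3 (VNum (pos c)) (VCons (VNum (area c)) (VNum (real (snd (snd c)))))"
  "case_val f1 f2 f3 (enc_entry z) = f3 (enc_node (fst z)) (enc_col (snd z))"
  "case_val f1 f2 f3 (enc_item a i) = f3 (VNum (real i)) (VNum (a i))"
  by (simp_all add: enc_node_def enc_col_def enc_entry_def enc_item_def)

text \<open>The penalty \<open>C\<close> is common to all rows and cannot influence column minima;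
  only \<open>link\<close> adds it. Columns at or left of the row's position obey the same
  formula.\<close>

definition entry :: "node \<Rightarrow> col \<Rightarrow> real" where
  "entry x c = cost x + (pos c - pos x) * (area c - area x)"

definition link :: "real \<Rightarrow> node \<Rightarrow> col \<Rightarrow> node" where
  "link C x c = (pos c, area c, entry x c + C, pos x # cuts x)"

lemma enc_col_Pair: "enc_col (j, s, u) = VCons (VNum j) (VCons (VNum s) (VNum (real u)))"
  by (simp add: enc_col_def)

lemma enc_node_link:
  "enc_node (link C x c) = VCons (VNum (pos c)) (VCons (VNum (area c))
     (VCons (VNum (entry x c + C)) (VCons (VNum (pos x)) (enc_list VNum (cuts x)))))"
  by (simp add: enc_node_def link_def)

lemma entry_returns: "returns (prog m) entry_fn [enc_node x, enc_col c] (VNum (entry x c)) 40"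
  unfolding returns_def wp_call_prog by (simp add: entry_body_def entry_def)

lemma labels_returns:
  "returns (prog m) (Suc 0) [enc_list (\<lambda>i. VNum (a i)) [k..<k + d], VNum (real k)]
     (enc_list (enc_item a) [k..<k + d]) (100 * d + 100)"
proof (induction d arbitrary: k)
  case 0
  show ?case
    unfolding returns_def wp_call_prog[unfolded One_nat_def] by (simp add: labels_body_def)
next
  case (Suc d)
  have upt: "[k..<k + Suc d] = k # [Suc k..<Suc (k + d)]"
    by (subst upt_conv_Cons) auto
  have IH: "returns (prog m) (Suc 0)
      [enc_list (\<lambda>i. VNum (a i)) [Suc k..<Suc (k + d)], VNum (real k + 1)]
      (enc_list (enc_item a) [Suc k..<Suc (k + d)]) (100 * d + 100)"
    using Suc.IH[of "Suc k"] by (simp add: add.commute del: upt_Suc)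
  show ?case
    unfolding returns_def wp_call_prog[unfolded One_nat_def] upt
    apply (simp add: labels_body_def del: upt_Suc)
    apply (rule wp_call_returns[OF IH])
    apply (simp add: enc_item_def del: upt_Suc)
    done
qed

lemma revapp_returns:
  "returns (prog m) revapp_fn [enc_list f xs, enc_list f ys] (enc_list f (rev xs @ ys))
     (10 * length xs + 10)"
proof (induction xs arbitrary: ys)
  case Nil
  show ?case unfolding returns_def wp_call_prog by (simp add: revapp_body_def)
next
  case (Cons x xs)
  show ?case
    unfolding returns_def wp_call_prog
    apply (simp add: revapp_body_def)
    apply (rule wp_call_returns[OF Cons.IH[of "x # ys", simplified]])
    apply simp
    done
qed

lemmas rev_returns = revapp_returns[where ys = "[]", simplified]

fun columns :: "(nat \<Rightarrow> real) \<Rightarrow> nat list \<Rightarrow> real \<Rightarrow> real \<Rightarrow> col list" where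
  "columns a [] j s = []"
| "columns a (u # us) j s = (j + 1, s + a u, u) # columns a us (j + 1) (s + a u)"

lemma columns_returns:
  "returns (prog m) columns_fn [enc_list (enc_item a) us, VNum j, VNum s]
     (enc_list enc_col (columns a us j s)) (50 * length us + 10)"
proof (induction us arbitrary: j s)
  case Nil
  show ?case unfolding returns_def wp_call_prog by (simp add: columns_body_def)
next
  case (Cons u us)
  show ?case
    unfolding returns_def wp_call_prog
    apply (simp add: columns_body_def)
    apply (rule wp_call_returns[OF Cons.IH])
    apply (simp add: enc_col_Pair)
    done
qed

lemma unstack_returns:
  "returns (prog m) unstack_fn [enc_list enc_entry st, enc_list enc_node xs]
     (enc_list enc_node (rev (map fst st) @ xs)) (20 * length st + 10)"
proof (induction st arbitrary: xs)
  case Nil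
  show ?case unfolding returns_def wp_call_prog by (simp add: unstack_body_def)
next
  case (Cons z st)
  show ?case
    unfolding returns_def wp_call_prog
    apply (simp add: unstack_body_def)
    apply (rule wp_call_returns[OF Cons.IH[of "fst z # xs", simplified]])
    apply simp
    done
qed

fun seconds :: "'a list \<Rightarrow> 'a list" where
  "seconds (c # d # cs) = d # seconds cs"
| "seconds _ = []"

lemma seconds_returns:
  "returns (prog m) seconds_fn [enc_list enc_col cs] (enc_list enc_col (seconds cs))
     (10 * length cs + 10)"
proof (induction cs rule: seconds.induct)
  case (1 c d cs)
  show ?case
    unfolding returns_def wp_call_prog
    apply (simp add: seconds_body_def)
    apply (rule wp_call_returns[OF 1])
    apply simp
    done
qed (unfold returns_def wp_call_prog, simp_all add: seconds_body_def)

text \<open>The row at which the scan stops has been compared but is handed back, as it may be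
  minimal for the next column too. Without a bounding row the scan runs to the end.\<close>

fun scan :: "node \<Rightarrow> node list \<Rightarrow> col \<Rightarrow> node list \<Rightarrow> node \<times> node list" where
  "scan b [] c rs = (b, [])"
| "scan b (x # xs) c rs = (let b' = (if entry x c < entry b c then x else b) in
     if rs = [] \<or> pos x < pos (hd rs) then scan b' xs c rs else (b', x # xs))"

lemma length_scan: "length (snd (scan b xs c rs)) \<le> length xs"
  by (induction b xs c rs rule: scan.induct) (auto simp: Let_def)

text \<open>Only consumed rows are charged, so that successive scans telescope to one pass over the
  rows.\<close>

lemma scan_returns:
  "returns (prog m) scan_fn [enc_node b, enc_list enc_node xs, enc_col c, enc_list enc_node rs]
     (VCons (enc_node (fst (scan b xs c rs))) (enc_list enc_node (snd (scan b xs c rs))))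
     (200 * (length xs - length (snd (scan b xs c rs))) + 200)"
proof (induction xs arbitrary: b rs)
  case Nil
  show ?case unfolding returns_def wp_call_prog by (simp add: scan_body_def)
next
  case (Cons x xs)
  show ?case
    unfolding returns_def wp_call_prog
    apply (cases "entry x c < entry b c"; cases rs)
    subgoal
      apply (simp add: scan_body_def)
      apply (rule wp_call_returns[OF entry_returns], simp)
      apply (rule wp_call_returns[OF entry_returns], simp)
      apply (rule wp_call_returns[OF Cons.IH[of x "[]", simplified]])
      using length_scan[of x xs c "[]"] apply simp
      done
    subgoal for r rs'
      apply (cases "pos x < pos r")
       apply (simp_all add: scan_body_def)
       apply (rule wp_call_returns[OF entry_returns], simp)
       apply (rule wp_call_returns[OF entry_returns], simp)
       apply (rule wp_call_returns[OF Cons.IH[of x "r # rs'", simplified]])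
      using length_scan[of x xs c "r # rs'"] apply simp
      apply (rule wp_call_returns[OF entry_returns], simp)
      apply (rule wp_call_returns[OF entry_returns], simp)
      done
    subgoal
      apply (simp add: scan_body_def)
      apply (rule wp_call_returns[OF entry_returns], simp)
      apply (rule wp_call_returns[OF entry_returns], simp)
      apply (rule wp_call_returns[OF Cons.IH[of b "[]", simplified]])
      using length_scan[of b xs c "[]"] apply simp
      done
    subgoal for r rs'
      apply (cases "pos x < pos r")
       apply (simp_all add: scan_body_def)
       apply (rule wp_call_returns[OF entry_returns], simp)
       apply (rule wp_call_returns[OF entry_returns], simp)
       apply (rule wp_call_returns[OF Cons.IH[of b "r # rs'", simplified]])
      using length_scan[of b xs c "r # rs'"] apply simp
      apply (rule wp_call_returns[OF entry_returns], simp)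
      apply (rule wp_call_returns[OF entry_returns], simp)
      done
    done
qed

lemma links_returns:
  "returns (prog m) links_fn [enc_list enc_node rows, enc_list enc_col cs, VNum C]
     (enc_list enc_node (map2 (link C) rows cs)) (100 * length cs + 10)"
proof (induction rows arbitrary: cs)
  case Nil
  show ?case
    unfolding returns_def wp_call_prog by (cases cs) (simp_all add: links_body_def)
next
  case (Cons x rows)
  show ?case
  proof (cases cs)
    case Nil
    then show ?thesis unfolding returns_def wp_call_prog by (simp add: links_body_def)
  next
    case [simp]: (Cons c cs')
    show ?thesis
      unfolding returns_def wp_call_prog
      apply (simp add: links_body_def)
      apply (rule wp_call_returns[OF entry_returns])
      apply simp
      apply (rule wp_call_returns[OF Cons.IH])
      apply (simp add: enc_node_link)
      done
  qed
qed

lemma prefix_returns: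
  "returns (prog m) prefix_fn [enc_list enc_node rows, enc_list enc_col cs]
     (enc_list enc_col (take (length rows) cs)) (20 * length rows + 10)"
proof (induction rows arbitrary: cs)
  case Nil
  show ?case unfolding returns_def wp_call_prog by (simp add: prefix_body_def)
next
  case (Cons x rows)
  show ?case
  proof (cases cs)
    case Nil
    then show ?thesis unfolding returns_def wp_call_prog by (simp add: prefix_body_def)
  next
    case [simp]: (Cons c cs')
    show ?thesis
      unfolding returns_def wp_call_prog
      apply (simp add: prefix_body_def)
      apply (rule wp_call_returns[OF Cons.IH])
      apply simp
      done
  qed
qed

text \<open>If no challenger wins, the old rows stay, since they may still be the best starts for
  later columns. A winner closes the block early, and the accepted nodes with the winner replace the
  old rows.\<close>

fun check :: "node list \<Rightarrow> node list \<Rightarrow> node list \<Rightarrow> col list \<Rightarrow> node list \<Rightarrow>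
    node list \<times> col list" where
  "check rows (x # xs) (y # ys) (c # cs) acc =
     (if cost y < cost x then (rev acc @ [y], cs) else check rows xs ys cs (x # acc))"
| "check rows _ _ cs acc = (rows @ rev acc, cs)"

text \<open>A tentative node is charged twice: for its comparison and for its later reversal out of
  the accumulator.\<close>

lemma check_returns:
  assumes "length ys = length xs" "length xs \<le> length cs"
  shows "returns (prog m) check_fn
     [enc_list enc_node rows, enc_list enc_node xs, enc_list enc_node ys, enc_list enc_col cs,
      enc_list enc_node acc]
     (VCons (enc_list enc_node (fst (check rows xs ys cs acc)))
        (enc_list enc_col (snd (check rows xs ys cs acc))))
     (100 * (length rows + 2 * length xs + length acc) + 100)"
  using assms
proof (induction xs arbitrary: ys cs acc)
  case Nil
  show ?case
    unfolding returns_def wp_call_prog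
    apply (simp add: check_body_def)
    apply (rule wp_call_returns[OF rev_returns])
    apply (rule wp_call_returns[OF rev_returns])
    apply (rule wp_call_returns[OF revapp_returns[where xs = "rev rows" and ys = "rev acc"]])
    apply simp
    done
next
  case (Cons x xs)
  obtain y ys' where [simp]: "ys = y # ys'" using Cons.prems by (cases ys) auto
  obtain c cs' where [simp]: "cs = c # cs'" using Cons.prems by (cases cs) auto
  have *: "length ys' = length xs" "length xs \<le> length cs'" using Cons.prems by auto
  show ?case
    unfolding returns_def wp_call_prog
    apply (simp add: check_body_def)
    apply (intro conjI impI)
     apply (rule wp_call_returns[OF rev_returns[where xs = "y # acc", simplified]])
     apply simp
    apply (rule wp_call_returns[OF Cons.IH[OF *, of "x # acc", simplified]])
    apply simp
    done
qed

section \<open>Merge sort\<close>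

fun split_list :: "'a list \<Rightarrow> 'a list \<times> 'a list" where
  "split_list [] = ([], [])"
| "split_list (x # xs) = (x # snd (split_list xs), fst (split_list xs))"

lemma split_returns:
  "returns (prog m) split_fn [enc_list f xs]
     (VCons (enc_list f (fst (split_list xs))) (enc_list f (snd (split_list xs))))
     (20 * length xs + 10)"
proof (induction xs)
  case Nil
  show ?case unfolding returns_def wp_call_prog by (simp add: split_body_def)
next
  case (Cons x xs)
  show ?case
    unfolding returns_def wp_call_prog
    apply (simp add: split_body_def)
    apply (rule wp_call_returns[OF Cons.IH])
    apply simp
    done
qed

fun merge :: "('a \<Rightarrow> real) \<Rightarrow> 'a list \<Rightarrow> 'a list \<Rightarrow> 'a list" where
  "merge a (x # xs) (y # ys) =
     (if a y < a x then y # merge a (x # xs) ys else x # merge a xs (y # ys))"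
| "merge a [] ys = ys"
| "merge a xs [] = xs"

lemma merge_returns:
  "returns (prog m) merge_fn [enc_list (enc_item a) xs, enc_list (enc_item a) ys]
     (enc_list (enc_item a) (merge a xs ys)) (30 * (length xs + length ys) + 30)"
proof (induction a xs ys rule: merge.induct)
  case (1 a x xs y ys)
  show ?case
    unfolding returns_def wp_call_prog
    apply (simp add: merge_body_def)
    apply (intro conjI impI)
     apply (rule wp_call_returns[OF "1.IH"(1)[simplified]])
      apply simp
     apply simp
    apply (rule wp_call_returns[OF "1.IH"(2)[simplified]])
     apply simp
    apply simp
    done
qed (unfold returns_def wp_call_prog, simp_all add: merge_body_def)

lemma mset_merge: "mset (merge a xs ys) = mset xs + mset ys"
  by (induction a xs ys rule: merge.induct) auto

lemma sorted_merge:
  "sorted (map a xs) \<Longrightarrow> sorted (map a ys) \<Longrightarrow> sorted (map a (merge a xs ys))"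
proof (induction a xs ys rule: merge.induct)
  case (1 a x xs y ys)
  have "set (merge a xs ys) = set xs \<union> set ys" for xs ys
    by (metis mset_merge set_mset_mset set_mset_union)
  then show ?case using 1 by fastforce
qed auto

lemma mset_split_list: "mset (fst (split_list xs)) + mset (snd (split_list xs)) = mset xs"
  by (induction xs) (auto simp: add_ac)

text \<open>Swapping the two outputs at each element deals the list out alternately, which balances
  the halves without counting.\<close>

lemma length_split_list:
  "length (fst (split_list xs)) = (length xs + 1) div 2"
  "length (snd (split_list xs)) = length xs div 2"
  by (induction xs) auto

text \<open>Induction on the recursion depth \<open>k\<close>, which becomes the logarithmic factor;
  each level adds \<open>200 * length us\<close> for splitting, merging and overhead.\<close>

lemma msort_returns:
  assumes "length us \<le> 2 ^ k"
  shows "\<exists>us'. returns (prog m) msort_fn [enc_list (enc_item a) us]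
      (enc_list (enc_item a) us') (200 * (k + 1) * length us + 10) \<and>
    mset us' = mset us \<and> sorted (map a us')"
  using assms
proof (induction k arbitrary: us)
  case 0
  then consider "us = []" | u where "us = [u]"
    by (cases us; cases "tl us") auto
  then show ?case
  proof cases
    case 1
    then show ?thesis
      unfolding returns_def wp_call_prog by (intro exI[of _ us]) (simp add: msort_body_def)
  next
    case 2
    then show ?thesis
      unfolding returns_def wp_call_prog by (intro exI[of _ us]) (simp add: msort_body_def)
  qed
next
  case (Suc k)
  consider "us = []" | u where "us = [u]" | u v ws where "us = u # v # ws"
    by (cases us; cases "tl us") auto
  then show ?case
  proof cases
    case 1
    then show ?thesis
      unfolding returns_def wp_call_prog by (intro exI[of _ us]) (simp add: msort_body_def)
  next
    case 2
    then show ?thesis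
      unfolding returns_def wp_call_prog by (intro exI[of _ us]) (simp add: msort_body_def)
  next
    case 3
    define l where "l = fst (split_list us)"
    define r where "r = snd (split_list us)"
    have len: "length l + length r = length us" "length l \<le> 2 ^ k" "length r \<le> 2 ^ k"
      using Suc.prems length_split_list[of us] unfolding l_def r_def by auto
    from Suc.IH[OF len(2)] obtain l' where l': "mset l' = mset l" "sorted (map a l')"
      "returns (prog m) msort_fn [enc_list (enc_item a) l]
        (enc_list (enc_item a) l') (200 * (k + 1) * length l + 10)" by blast
    from Suc.IH[OF len(3)] obtain r' where r': "mset r' = mset r" "sorted (map a r')"
      "returns (prog m) msort_fn [enc_list (enc_item a) r]
        (enc_list (enc_item a) r') (200 * (k + 1) * length r + 10)" by blast
    have len': "length l' = length l" "length r' = length r"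
      using l'(1) r'(1) by (metis size_mset)+
    have us2: "length us \<ge> 2" using 3 by simp
    have bnd: "t1 + t2 + t3 + t4 + 40 \<le> 200 * (Suc k + 1) * length us + 10"
      if "t1 \<le> 20 * length us + 10" "t2 \<le> 200 * (k + 1) * length l + 10"
        "t3 \<le> 200 * (k + 1) * length r + 10" "t4 \<le> 30 * (length l' + length r') + 30"
      for t1 t2 t3 t4
    proof -
      have "t2 + t3 \<le> 200 * (k + 1) * length us + 20"
        using that(2,3) unfolding len(1)[symmetric] by (simp add: algebra_simps)
      moreover have "t1 + t4 + 50 \<le> 200 * length us"
        using that(1,4) us2 by (simp add: len' len(1))
      ultimately show ?thesis by (simp add: algebra_simps)
    qed
    have "returns (prog m) msort_fn [enc_list (enc_item a) us]
      (enc_list (enc_item a) (merge a l' r')) (200 * (Suc k + 1) * length us + 10)"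
      unfolding returns_def wp_call_prog
      apply (simp add: msort_body_def 3)
      apply (rule wp_call_returns[OF split_returns[of m "enc_item a" us, folded l_def r_def, unfolded 3, simplified]])
      apply simp
      apply (rule wp_call_returns[OF l'(3)])
      apply simp
      apply (rule wp_call_returns[OF r'(3)])
      apply simp
      apply (rule wp_call_returns[OF merge_returns])
      subgoal for t1 t2 t3 t4
        using bnd[of t1 t2 t3 t4] 3 by simp
      done
    moreover have "mset (merge a l' r') = mset us"
      by (simp add: mset_merge l' r' l_def r_def mset_split_list)
    ultimately show ?thesis using sorted_merge[OF l'(2) r'(2)] by blast
  qed
qed


section \<open>Row minima of Monge matrices (SMAWK)\<close>

text \<open>Positions increase strictly, so that \<open>scan\<close> can tell rows apart by
  position. The relation serves rows and columns alike.\<close>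

definition prec :: "real \<times> real \<times> 'a \<Rightarrow> real \<times> real \<times> 'b \<Rightarrow> bool" where
  "prec x y \<longleftrightarrow> pos x < pos y \<and> area x \<le> area y"

lemma prec_trans: "prec x y \<Longrightarrow> prec y z \<Longrightarrow> prec x z"
  by (auto simp: prec_def)

text \<open>The costs cancel, and what remains is a sum of two products of nonnegative differences.
  Rows are only compared with rows and columns with columns, so a column may lie left of a
  row.\<close>

lemma entry_monge:
  assumes "prec x y" "prec c d"
  shows "entry x c + entry y d \<le> entry x d + entry y c"
proof -
  have "0 \<le> (pos d - pos c) * (area y - area x) + (pos y - pos x) * (area d - area c)"
    using assms by (simp add: prec_def)
  then show ?thesis by (simp add: entry_def algebra_simps)
qed

text \<open>Total monotonicity in a form tolerant of ties: a weak win of the later row persists to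
  the right, one of the earlier row (\<open>entry_le_left\<close>) to the left.\<close>

lemma entry_le_right:
  "prec x y \<Longrightarrow> d = c \<or> prec c d \<Longrightarrow> entry y c \<le> entry x c \<Longrightarrow> entry y d \<le> entry x d"
  using entry_monge[of x y c d] by auto

lemma entry_le_left:
  "prec x y \<Longrightarrow> c = d \<or> prec c d \<Longrightarrow> entry x d \<le> entry y d \<Longrightarrow> entry x c \<le> entry y c"
  using entry_monge[of x y c d] by auto

section \<open>Column minima and the stack reduction\<close>

definition minimizes :: "node set \<Rightarrow> node \<Rightarrow> col \<Rightarrow> bool" where
  "minimizes R x c \<longleftrightarrow> x \<in> R \<and> (\<forall>y\<in>R. entry x c \<le> entry y c)"

text \<open>The lower row weakly wins its own column against the row above it, hence by monotonicity
  every earlier column as well.\<close>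

fun stacked :: "(node \<times> col) list \<Rightarrow> bool" where
  "stacked ((y, d) # (x, c) # st) \<longleftrightarrow> entry x c \<le> entry y c \<and> stacked ((x, c) # st)"
| "stacked _ \<longleftrightarrow> True"

lemma stacked_Cons: "stacked (z # st) \<Longrightarrow> stacked st"
  by (cases z; cases st) auto

text \<open>A row popped off the stack is dominated by the new row from its own column on, and by its
  predecessor on the stack before.\<close>

lemma popped_dominated:
  assumes "sorted_wrt prec (rev (map fst ((s, c) # st)) @ i # rows)"
    and "sorted_wrt prec (rev (map snd ((s, c) # st)) @ rem)"
    and "stacked ((s, c) # st)" "entry i c < entry s c"
    and "d \<in> insert c (snd ` set st \<union> set rem)"
  shows "\<exists>y \<in> insert i (fst ` set st). entry y d \<le> entry s d"
proof (cases "d \<in> snd ` set st")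
  case False
  then have "d = c \<or> prec c d" using assms(2,5) by (auto simp: sorted_wrt_append)
  moreover have "prec s i" using assms(1) by (auto simp: sorted_wrt_append)
  ultimately show ?thesis using assms(4) by (auto intro: entry_le_right)
next
  case True
  then obtain s' c' st' where st: "st = (s', c') # st'" by (cases st) auto
  have "d = c' \<or> prec d c'" using assms(2) True by (auto simp: st sorted_wrt_append)
  moreover have "prec s' s" using assms(1) by (auto simp: st sorted_wrt_append)
  moreover have "entry s' c' \<le> entry s c'" using assms(3) by (simp add: st)
  ultimately show ?thesis by (auto simp: st intro: entry_le_left)
qed

text \<open>A push trades a row for a stack entry, a pop gives the entry's column back to
  \<open>rem\<close>; both lower \<open>2 * length rows + length st\<close>, which is induction
  measure and time bound in one. Every surviving row owns a column, whence the bound on their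
  number. Domination by some survivor in each column, rather than minimality, is what composes along
  the induction.\<close>

lemma reduce_returns:
  assumes "sorted_wrt prec (rev (map fst st) @ rows)" "sorted_wrt prec (rev (map snd st) @ rem)"
    and "stacked st"
  shows "\<exists>rows'.
    returns (prog m) reduce_fn
      [enc_list enc_node rows, enc_list enc_entry st, enc_list enc_col rem]
      (enc_list enc_node rows') (200 * (2 * length rows + length st) + 100) \<and>
    set rows' \<subseteq> fst ` set st \<union> set rows \<and> sorted_wrt prec rows' \<and>
    length rows' \<le> length st + length rem \<and>
    (\<forall>x \<in> fst ` set st \<union> set rows. \<forall>c \<in> snd ` set st \<union> set rem.
       \<exists>y \<in> set rows'. entry y c \<le> entry x c)"
  (is "\<exists>rows'. ?ret rows st rem rows' \<and> ?sub rows st rows' \<and> _ \<and> ?len st rem rows' \<and>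
    ?dom rows st rem rows'")
  using assms
proof (induction "2 * length rows + length st" arbitrary: rows st rem rule: less_induct)
  case less
  note IH = less.hyps and prems = less.prems
  show ?case
  proof (cases rows)
    case [simp]: Nil
    have "?ret rows st rem (rev (map fst st))"
      unfolding returns_def wp_call_prog
      apply (simp add: reduce_body_def)
      apply (rule wp_call_returns[OF unstack_returns[where xs = "[]", simplified]])
      apply simp
      done
    then show ?thesis
      using prems by (intro exI[of _ "rev (map fst st)"]) (auto simp: rev_map)
  next
    case [simp]: (Cons i rows1)
    show ?thesis
    proof (cases st)
      case [simp]: Nil
      show ?thesis
      proof (cases rem)
        case Nil
        then have "?ret rows st rem []"
          unfolding returns_def wp_call_prog by (simp add: reduce_body_def)
        then show ?thesis using Nil by (intro exI[of _ "[]"]) auto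
      next
        case [simp]: (Cons c rem1)
        obtain rows' where rows': "?ret rows1 [(i, c)] rem1 rows'" "?sub rows1 [(i, c)] rows'"
          "sorted_wrt prec rows'" "?len [(i, c)] rem1 rows'" "?dom rows1 [(i, c)] rem1 rows'"
          using IH[of rows1 "[(i, c)]" rem1] prems by (simp add: sorted_wrt_append) blast
        have "?ret rows st rem rows'"
          unfolding returns_def wp_call_prog
          apply (simp add: reduce_body_def)
          apply (rule wp_call_returns[OF rows'(1)[simplified enc_entry_def, simplified]])
          apply simp
          done
        then show ?thesis using rows' by (intro exI[of _ rows']) auto
      qed
    next
      case (Cons z st1)
      obtain s c where "z = (s, c)" by (cases z) auto
      with Cons have [simp]: "st = (s, c) # st1" by simp
      show ?thesis
      proof (cases "entry i c < entry s c")
        case True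
        obtain rows' where rows': "?ret rows st1 (c # rem) rows'" "?sub rows st1 rows'"
          "sorted_wrt prec rows'" "?len st1 (c # rem) rows'" "?dom rows st1 (c # rem) rows'"
        proof -
          have "sorted_wrt prec (rev (map fst st1) @ rows)"
            "sorted_wrt prec (rev (map snd st1) @ c # rem)" "stacked st1"
            using prems stacked_Cons by (auto simp: sorted_wrt_append)
          then show thesis using IH[of rows st1 "c # rem"] that by auto
        qed
        have "?ret rows st rem rows'"
          unfolding returns_def wp_call_prog
          apply (simp add: reduce_body_def enc_entry_def)
          apply (rule wp_call_returns[OF entry_returns])
          apply simp
          apply (rule wp_call_returns[OF entry_returns])
          apply (simp add: True)
          apply (rule wp_call_returns[OF rows'(1)[simplified]])
          apply simp
          done
        moreover have "?dom rows st rem rows'"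
        proof (intro ballI)
          fix x d
          assume x: "x \<in> fst ` set st \<union> set rows" and d: "d \<in> snd ` set st \<union> set rem"
          have d': "d \<in> snd ` set st1 \<union> set (c # rem)" using d by auto
          obtain x' where "x' \<in> fst ` set st1 \<union> set rows" "entry x' d \<le> entry x d"
          proof (cases "x = s")
            case True
            have "\<exists>y \<in> insert i (fst ` set st1). entry y d \<le> entry s d"
              by (rule popped_dominated[of s c st1 i rows1 rem d]) (use prems(1-3) \<open>entry i c < entry s c\<close> d in simp_all)
            then obtain y where "y \<in> insert i (fst ` set st1)" "entry y d \<le> entry s d" by blast
            moreover from this(1) have "y \<in> fst ` set st1 \<union> set rows" by auto
            ultimately show thesis using True that by blast
          next
            case False
            then show thesis using x that[of x] by auto
          qed
          then show "\<exists>y \<in> set rows'. entry y d \<le> entry x d"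
            using rows'(5) d' by (meson order_trans)
        qed
        ultimately show ?thesis using rows' by (intro exI[of _ rows']) auto
      next
        case False
        show ?thesis
        proof (cases rem)
          case [simp]: Nil
          obtain rows' where rows': "?ret rows1 st rem rows'" "?sub rows1 st rows'"
            "sorted_wrt prec rows'" "?len st rem rows'" "?dom rows1 st rem rows'"
          proof -
            have "sorted_wrt prec (rev (map fst st) @ rows1)"
              using prems by (auto simp: sorted_wrt_append)
            then show thesis using IH[of rows1 st rem] prems that by auto
          qed
          have "?ret rows st rem rows'"
            unfolding returns_def wp_call_prog
            apply (simp add: reduce_body_def enc_entry_def)
            apply (rule wp_call_returns[OF entry_returns])
            apply simp
            apply (rule wp_call_returns[OF entry_returns])
            apply (simp add: False)
            apply (rule wp_call_returns[OF rows'(1)[simplified, simplified enc_entry_def, simplified]])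
            apply simp
            done
          \<comment> \<open>No column is left beyond \<open>c\<close>, where the top row
            \<open>s\<close> already wins; so \<open>s\<close> is no worse than the new row in every
            column.\<close>
          moreover have "?dom rows st rem rows'"
          proof (intro ballI)
            fix x d
            assume x: "x \<in> fst ` set st \<union> set rows" and d: "d \<in> snd ` set st \<union> set rem"
            have "d = c \<or> prec d c" using d prems(2) by (auto simp: sorted_wrt_append)
            moreover have "prec s i" using prems(1) by (auto simp: sorted_wrt_append)
            ultimately have "entry s d \<le> entry i d" using False by (auto intro: entry_le_left)
            moreover have "s \<in> fst ` set st \<union> set rows1" by simp
            ultimately obtain x' where "x' \<in> fst ` set st \<union> set rows1" "entry x' d \<le> entry x d"
              using x by (cases "x = i") (blast, auto)
            then show "\<exists>y \<in> set rows'. entry y d \<le> entry x d"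
              using rows'(5) d by (meson order_trans)
          qed
          ultimately show ?thesis using rows' by (intro exI[of _ rows']) auto
        next
          case [simp]: (Cons c' rem1)
          let ?st = "(i, c') # st"
          obtain rows' where rows': "?ret rows1 ?st rem1 rows'" "?sub rows1 ?st rows'"
            "sorted_wrt prec rows'" "?len ?st rem1 rows'" "?dom rows1 ?st rem1 rows'"
          proof -
            have "sorted_wrt prec (rev (map fst ?st) @ rows1)"
              "sorted_wrt prec (rev (map snd ?st) @ rem1)" "stacked ?st"
              using prems False by simp_all
            moreover have "2 * length rows1 + length ?st < 2 * length rows + length st" by simp
            ultimately show thesis using IH[of rows1 ?st rem1] that by blast
          qed
          have "?ret rows st rem rows'"
            unfolding returns_def wp_call_prog
            apply (simp add: reduce_body_def enc_entry_def)
            apply (rule wp_call_returns[OF entry_returns])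
            apply simp
            apply (rule wp_call_returns[OF entry_returns])
            apply (simp add: False)
            apply (rule wp_call_returns[OF rows'(1)[simplified, simplified enc_entry_def, simplified]])
            apply simp
            done
          then show ?thesis using rows' by (intro exI[of _ rows']) auto
        qed
      qed
    qed
  qed
qed

section \<open>Interpolation between the minima of every second column\<close>

lemma scan_le: "entry (fst (scan b xs c rs)) c \<le> entry b c"
  by (induction b xs c rs rule: scan.induct) (auto simp: Let_def)

lemma scan_in: "fst (scan b xs c rs) \<in> insert b (set xs)"
  by (induction b xs c rs rule: scan.induct) (auto simp: Let_def)

lemma scan_unbounded: "x \<in> set xs \<Longrightarrow> entry (fst (scan b xs c [])) c \<le> entry x c"
proof (induction xs arbitrary: b)
  case (Cons y xs)
  define b' where "b' = (if entry y c < entry b c then y else b)"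
  have *: "scan b (y # xs) c [] = scan b' xs c []" by (simp add: b'_def Let_def)
  have "entry (fst (scan b' xs c [])) c \<le> entry b' c" by (rule scan_le)
  moreover have "entry b' c \<le> entry y c" by (simp add: b'_def)
  ultimately show ?case using Cons unfolding * by (cases "x = y") auto
qed simp

lemma scan_bounded:
  "\<exists>ys. xs = ys @ snd (scan b xs c (r # rs)) \<and>
     (\<forall>y \<in> set ys. pos y < pos r \<and> entry (fst (scan b xs c (r # rs))) c \<le> entry y c) \<and>
     (\<forall>x zs. snd (scan b xs c (r # rs)) = x # zs \<longrightarrow>
        pos r \<le> pos x \<and> entry (fst (scan b xs c (r # rs))) c \<le> entry x c)"
proof (induction xs arbitrary: b)
  case (Cons y xs)
  define b' where "b' = (if entry y c < entry b c then y else b)"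
  show ?case
  proof (cases "pos y < pos r")
    case True
    then have *: "scan b (y # xs) c (r # rs) = scan b' xs c (r # rs)"
      by (simp add: b'_def Let_def)
    have "entry (fst (scan b' xs c (r # rs))) c \<le> entry y c"
      using scan_le[of b' xs c "r # rs"] by (auto simp: b'_def split: if_splits)
    moreover obtain ys where "xs = ys @ snd (scan b' xs c (r # rs))"
      "\<forall>y \<in> set ys. pos y < pos r \<and> entry (fst (scan b' xs c (r # rs))) c \<le> entry y c"
      "\<forall>x zs. snd (scan b' xs c (r # rs)) = x # zs \<longrightarrow>
        pos r \<le> pos x \<and> entry (fst (scan b' xs c (r # rs))) c \<le> entry x c"
      using Cons.IH[of b'] by blast
    ultimately show ?thesis
      unfolding * using True by (intro exI[of _ "y # ys"]) auto
  next
    case False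
    then show ?thesis by (intro exI[of _ "[]"]) (auto simp: Let_def)
  qed
qed simp

text \<open>Ties are broken arbitrarily, so the minimal rows of successive columns need not move
  rightwards, and the given row \<open>r\<close> may already have been passed. The invariant
  therefore allows rows outside the current list, provided that its head lies to their right and is
  no worse in all columns to come.\<close>

lemma interpolate_returns:
  assumes "rows \<noteq> []" "sorted_wrt prec rows" "set rows \<subseteq> R" "sorted_wrt prec cs"
    and "\<forall>x\<in>R. x \<in> set rows \<or> prec x (hd rows) \<and> (\<forall>c\<in>set cs. entry (hd rows) c \<le> entry x c)"
    and "list_all2 (minimizes R) rs (seconds cs)"
  shows "\<exists>res.
    returns (prog m) interpolate_fn
      [enc_list enc_node rows, enc_list enc_col cs, enc_list enc_node rs]
      (enc_list enc_node res) (200 * length rows + 300 * length cs + 10) \<and>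
    list_all2 (minimizes R) res cs"
  using assms
proof (induction cs arbitrary: rows rs rule: seconds.induct)
  case (1 c d cs)
  note prems = "1.prems"
  obtain p rows0 where rows: "rows = p # rows0" using prems(1) by (cases rows) auto
  obtain r rs1 where rs [simp]: "rs = r # rs1" and r: "minimizes R r d"
    and rs1: "list_all2 (minimizes R) rs1 (seconds cs)"
    using prems(6) by (cases rs) auto
  define b where "b = fst (scan p rows c rs)"
  define xs where "xs = snd (scan p rows c rs)"
  have sc: "scan p rows c rs = (b, xs)" by (simp add: b_def xs_def)
  obtain ys where ys: "rows = ys @ xs" "\<forall>y \<in> set ys. pos y < pos r \<and> entry b c \<le> entry y c"
    "\<forall>x zs. xs = x # zs \<longrightarrow> pos r \<le> pos x \<and> entry b c \<le> entry x c"
    using scan_bounded[of rows p c r rs1] sc by auto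
  have r_in: "r \<in> set rows \<or> prec r p \<and> entry p d \<le> entry r d"
    using prems(5) r by (auto simp: minimizes_def rows)
  have "xs \<noteq> []"
  proof
    assume "xs = []"
    then have "\<forall>y \<in> set rows. pos y < pos r" using ys by auto
    then show False using r_in by (auto simp: rows prec_def)
  qed
  then obtain x0 zs where xs: "xs = x0 # zs" by (cases xs) auto
  \<comment> \<open>If \<open>r\<close> is still in the list, the scan stops exactly there.
    Otherwise the head \<open>p\<close> ties with \<open>r\<close> at \<open>d\<close>, and the scan
    stops immediately at \<open>p\<close>.\<close>
  have x0: "minimizes R x0 d"
  proof (cases "r \<in> set rows")
    case True
    have "pos r \<le> pos x0" using ys(3) xs by auto
    moreover have "\<forall>z \<in> set zs. pos x0 < pos z"
      using prems(2) ys(1) xs by (auto simp: sorted_wrt_append prec_def)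
    ultimately have "r = x0" using True ys(1,2) xs by force
    then show ?thesis using r by simp
  next
    case False
    with r_in have rp: "prec r p" "entry p d \<le> entry r d" by auto
    have "ys = []" using ys(1,2) rp(1) by (cases ys) (auto simp: rows prec_def)
    then have "x0 = p" using ys(1) xs rows by simp
    then show ?thesis using rp(2) r prems(3) by (auto simp: minimizes_def rows intro: order_trans)
  qed
  have cd: "prec c d" "\<forall>c'\<in>set cs. prec d c'" using prems(4) by auto
  have b_in: "b \<in> R" using scan_in[of p rows c rs] prems(3) rows b_def by auto
  have b: "minimizes R b c"
    unfolding minimizes_def
  proof (intro conjI ballI b_in)
    fix x assume x: "x \<in> R"
    show "entry b c \<le> entry x c"
    proof (cases "x \<in> set rows")
      case False
      then have "entry p c \<le> entry x c" using prems(5) x rows by auto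
      moreover have "entry b c \<le> entry p c" using scan_le[of p rows c rs] b_def by simp
      ultimately show ?thesis by simp
    next
      case True
      then consider "x \<in> set ys" | "x = x0" | "x \<in> set zs" using ys(1) xs by auto
      then show ?thesis
      proof cases
        case 3
        \<comment> \<open>Rows beyond \<open>x0\<close> were never scanned: being no better than
          \<open>x0\<close> at \<open>d\<close>, they are no better at the earlier column
          \<open>c\<close>.\<close>
        then have "prec x0 x" using prems(2) ys(1) xs by (auto simp: sorted_wrt_append)
        then have "entry x0 c \<le> entry x c"
          using entry_le_left[of x0 x c d] cd x0 x by (auto simp: minimizes_def)
        then show ?thesis using ys(3) xs by auto
      qed (use ys xs in auto)
    qed
  qed
  \<comment> \<open>Rows left of \<open>x0\<close> are no better than it at \<open>d\<close>, hence
    at no later column.\<close>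
  have inv: "\<forall>x\<in>R. x \<in> set xs \<or> prec x (hd xs) \<and> (\<forall>c'\<in>set cs. entry (hd xs) c' \<le> entry x c')"
  proof (intro ballI disjCI)
    fix x assume x: "x \<in> R" "\<not> (prec x (hd xs) \<and> (\<forall>c'\<in>set cs. entry (hd xs) c' \<le> entry x c'))"
    show "x \<in> set xs"
    proof (rule ccontr)
      assume nx: "x \<notin> set xs"
      have px: "p = x0 \<or> prec p x0"
        using prems(2) ys(1) xs rows by (cases ys) (auto simp: sorted_wrt_append)
      have "prec x x0"
      proof (cases "x \<in> set rows")
        case True
        then show ?thesis using nx prems(2) ys(1) xs by (auto simp: sorted_wrt_append)
      next
        case False
        then have "prec x p" using prems(5) x rows by auto
        then show ?thesis using px by (metis prec_trans)
      qed
      moreover from this have "entry x0 c' \<le> entry x c'" if "c' \<in> set cs" for c'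
        using entry_le_right[of x x0 c' d] cd x0 x that by (auto simp: minimizes_def)
      ultimately show False using x xs by auto
    qed
  qed
  have "sorted_wrt prec xs" "set xs \<subseteq> R" "sorted_wrt prec cs"
    using prems(2,3,4) ys(1) by (auto simp: sorted_wrt_append)
  from "1.IH"[OF \<open>xs \<noteq> []\<close> this inv rs1] obtain res where res:
    "returns (prog m) interpolate_fn
      [enc_list enc_node xs, enc_list enc_col cs, enc_list enc_node rs1]
      (enc_list enc_node res) (200 * length xs + 300 * length cs + 10)"
    "list_all2 (minimizes R) res cs" by blast
  note sr = scan_returns[of m p rows c rs, unfolded sc fst_conv snd_conv, unfolded rows rs, simplified]
  have len: "length xs \<le> Suc (length rows0)" using ys(1) rows by (metis length_Cons length_append le_add2)
  have "returns (prog m) interpolate_fn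
      [enc_list enc_node rows, enc_list enc_col (c # d # cs), enc_list enc_node rs]
      (enc_list enc_node (b # r # res)) (200 * length rows + 300 * length (c # d # cs) + 10)"
    unfolding returns_def wp_call_prog
    apply (simp add: interpolate_body_def rows)
    apply (rule wp_call_returns[OF sr])
    apply simp
    apply (rule wp_call_returns[OF res(1)])
    using len apply simp
    done
  then show ?case using b r res(2) by (intro exI[of _ "b # r # res"]) auto
next
  case "2_1"
  then show ?case
    unfolding returns_def wp_call_prog by (intro exI[of _ "[]"]) (simp add: interpolate_body_def)
next
  case ("2_2" c)
  note prems = "2_2.prems"
  from prems have [simp]: "rs = []" by simp
  obtain p rows0 where rows: "rows = p # rows0" using prems by (cases rows) auto
  define b where "b = fst (scan p rows c [])"
  note sr = scan_returns[of m p rows c "[]", folded b_def, unfolded rows, simplified]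
  have "minimizes R b c"
    unfolding minimizes_def
  proof (intro conjI ballI)
    show "b \<in> R" using scan_in[of p rows c "[]"] prems(3) rows b_def by auto
    fix x assume "x \<in> R"
    then show "entry b c \<le> entry x c"
      using prems(5) scan_unbounded[of x rows p c] scan_le[of p rows c "[]"] rows b_def by force
  qed
  moreover have "returns (prog m) interpolate_fn
      [enc_list enc_node rows, enc_list enc_col [c], enc_list enc_node rs]
      (enc_list enc_node [b]) (200 * length rows + 300 * length [c] + 10)"
    unfolding returns_def wp_call_prog
    apply (simp add: interpolate_body_def rows)
    apply (rule wp_call_returns[OF sr])
    apply simp
    done
  ultimately show ?case by (intro exI[of _ "[b]"]) auto
qed

section \<open>The SMAWK recursion\<close>

lemma length_seconds: "length (seconds cs) = length cs div 2"
  by (induction cs rule: seconds.induct) auto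

lemma set_seconds: "set (seconds cs) \<subseteq> set cs"
  by (induction cs rule: seconds.induct) auto

lemma sorted_seconds: "sorted_wrt P cs \<Longrightarrow> sorted_wrt P (seconds cs)"
  using set_seconds by (induction cs rule: seconds.induct) fastforce+

text \<open>After the reduction there are at most as many rows as columns, so per column the
  recursive call on half the columns costs about 1500 and the interpolation 500. This leaves a
  margin below 2200.\<close>

lemma smawk_returns:
  assumes "rows \<noteq> []" "sorted_wrt prec rows" "sorted_wrt prec cs"
  shows "\<exists>res.
    returns (prog m) smawk_fn [enc_list enc_node rows, enc_list enc_col cs]
      (enc_list enc_node res) (400 * length rows + 2200 * length cs + 100) \<and>
    list_all2 (minimizes (set rows)) res cs"
  using assms
proof (induction "length cs" arbitrary: rows cs rule: less_induct)
  case less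
  show ?case
  proof (cases cs)
    case Nil
    then show ?thesis
      unfolding returns_def wp_call_prog by (intro exI[of _ "[]"]) (simp add: smawk_body_def)
  next
    case (Cons c cs')
    obtain rows' where rows':
      "returns (prog m) reduce_fn [enc_list enc_node rows, VNil, enc_list enc_col cs]
         (enc_list enc_node rows') (400 * length rows + 100)"
      "set rows' \<subseteq> set rows" "sorted_wrt prec rows'" "length rows' \<le> length cs"
      "\<forall>x\<in>set rows. \<forall>c\<in>set cs. \<exists>y\<in>set rows'. entry y c \<le> entry x c"
      using reduce_returns[of "[]" rows cs m] less.prems by (auto simp: mult_ac)
    have "rows' \<noteq> []" using rows'(5) less.prems(1) Cons by (cases rows) auto
    moreover have "length (seconds cs) < length cs" using Cons by (simp add: length_seconds)
    ultimately obtain rs where rs: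
      "returns (prog m) smawk_fn [enc_list enc_node rows', enc_list enc_col (seconds cs)]
        (enc_list enc_node rs) (400 * length rows' + 2200 * length (seconds cs) + 100)"
      "list_all2 (minimizes (set rows')) rs (seconds cs)"
      using less.hyps[of "seconds cs" rows'] rows'(3) sorted_seconds[OF less.prems(3)] by blast
    obtain res where res:
      "returns (prog m) interpolate_fn
        [enc_list enc_node rows', enc_list enc_col cs, enc_list enc_node rs]
        (enc_list enc_node res) (200 * length rows' + 300 * length cs + 10)"
      "list_all2 (minimizes (set rows')) res cs"
      using interpolate_returns[OF \<open>rows' \<noteq> []\<close> rows'(3) order_refl less.prems(3) _ rs(2)] by blast
    have "list_all2 (minimizes (set rows)) res cs"
      unfolding list_all2_conv_all_nth
    proof (intro conjI allI impI)
      fix k assume k: "k < length res"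
      have "minimizes (set rows') (res ! k) (cs ! k)" "cs ! k \<in> set cs"
        using res(2) k by (auto simp: list_all2_conv_all_nth)
      then show "minimizes (set rows) (res ! k) (cs ! k)"
        unfolding minimizes_def using rows'(2,5) by (meson order_trans subsetD)
    qed (use res(2) in \<open>simp add: list_all2_conv_all_nth\<close>)
    moreover have "returns (prog m) smawk_fn [enc_list enc_node rows, enc_list enc_col cs]
      (enc_list enc_node res) (400 * length rows + 2200 * length cs + 100)"
      unfolding returns_def wp_call_prog
      apply (simp add: smawk_body_def)
      apply (simp add: Cons)
      apply (rule wp_call_returns[OF rows'(1)[unfolded Cons, simplified]])
      apply (rule wp_call_returns[OF seconds_returns[of m cs, unfolded Cons, simplified]])
      apply (rule wp_call_returns[OF rs(1)[unfolded Cons, simplified]])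
      apply (rule wp_call_returns[OF res(1)[unfolded Cons, simplified]])
      using rows'(4) Cons apply (simp add: length_seconds)
      done
    ultimately show ?thesis by blast
  qed
qed


section \<open>Least weight subsequences (Wilber)\<close>

locale items =
  fixes a :: "nat \<Rightarrow> real" and lab :: "nat \<Rightarrow> nat" and C :: real
  assumes area_nonneg: "0 \<le> a (lab j)" and C_pos: "0 < C"
begin

section \<open>The recurrence, and the layerings behind nodes\<close>

definition pre :: "nat \<Rightarrow> real" where
  "pre j = (\<Sum>k\<in>{1..j}. a (lab k))"

definition w :: "nat \<Rightarrow> nat \<Rightarrow> real" where
  "w i j = (real j - real i) * (pre j - pre i)"

definition colof :: "nat \<Rightarrow> col" where
  "colof j = (real j, pre j, lab j)"

fun opt :: "nat \<Rightarrow> real" where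
  "opt 0 = 0"
| "opt (Suc j) = Min ((\<lambda>i. opt i + w i (Suc j) + C) ` {..j})"

text \<open>Arbitrary contiguous layerings, not only optimal ones: a tentative node carries an
  actual layering too, so that \<open>opt\<close> bounds its cost from below.\<close>

inductive path :: "nat \<Rightarrow> real \<Rightarrow> real list \<Rightarrow> bool" where
  path_0: "path 0 0 []"
| path_step: "path i F b \<Longrightarrow> i < j \<Longrightarrow> path j (F + w i j + C) (real i # b)"

definition node_at :: "nat \<Rightarrow> node \<Rightarrow> bool" where
  "node_at j x \<longleftrightarrow> pos x = real j \<and> area x = pre j \<and> path j (cost x) (cuts x)"

definition exact :: "nat \<Rightarrow> node \<Rightarrow> bool" where
  "exact j x \<longleftrightarrow> node_at j x \<and> cost x = opt j"

lemma pre_mono: "i \<le> j \<Longrightarrow> pre i \<le> pre j"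
  unfolding pre_def by (intro sum_mono2) (auto simp: area_nonneg)

text \<open>Below the diagonal both factors are nonpositive.\<close>

lemma w_nonneg: "0 \<le> w i j"
  by (cases "i \<le> j") (auto simp: w_def pre_mono mult_nonpos_nonpos)

lemma opt_le: "i < j \<Longrightarrow> opt j \<le> opt i + w i j + C"
  by (cases j) (auto intro!: Min_le)

lemma opt_attained:
  assumes "0 < j"
  obtains i where "i < j" "opt j = opt i + w i j + C"
proof -
  obtain k where j: "j = Suc k" using assms by (cases j) auto
  have "opt j \<in> (\<lambda>i. opt i + w i (Suc k) + C) ` {..k}"
    unfolding j opt.simps by (rule Min_in) auto
  then obtain i where "i \<le> k" "opt j = opt i + w i (Suc k) + C" by auto
  then show thesis using that[of i] j by (auto simp del: opt.simps)
qed

text \<open>Truncating an optimal layering of the first \<open>j\<close> items to the first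
  \<open>i\<close> does not raise its cost: the last layer disappears (\<open>i \<le> k\<close>) or
  shrinks.\<close>

lemma opt_mono: "i \<le> j \<Longrightarrow> opt i \<le> opt j"
proof (induction j arbitrary: i rule: less_induct)
  case (less j)
  show ?case
  proof (cases "i = j")
    case False
    then have "i < j" using less.prems by simp
    then obtain k where k: "k < j" "opt j = opt k + w k j + C"
      using opt_attained[of j] by auto
    show ?thesis
    proof (cases "i \<le> k")
      case True
      then show ?thesis using less.IH[OF k(1), of i] k(2) w_nonneg[of k j] C_pos by linarith
    next
      case False
      then have "w k i \<le> w k j"
        using \<open>i < j\<close> pre_mono[of i j] pre_mono[of k i] unfolding w_def by (intro mult_mono) auto
      then show ?thesis using opt_le[of k i] False k(2) by linarith
    qed
  qed simp
qed

lemma opt_le_path: "path j F b \<Longrightarrow> opt j \<le> F"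
proof (induction rule: path.induct)
  case (path_step i F b j)
  then show ?case using opt_le[of i j] by linarith
qed simp

lemma entry_colof: "node_at i x \<Longrightarrow> entry x (colof j) = cost x + w i j"
  by (simp add: entry_def colof_def node_at_def w_def)

lemma cost_link: "node_at i x \<Longrightarrow> cost (link C x (colof j)) = cost x + w i j + C"
  using entry_colof[of i x j] by (simp add: link_def)

lemma node_at_link: "node_at i x \<Longrightarrow> i < j \<Longrightarrow> node_at j (link C x (colof j))"
  using entry_colof[of i x j] path_step[of i "cost x" "cuts x" j]
  by (simp add: link_def node_at_def colof_def)

lemma opt_le_cost: "node_at j x \<Longrightarrow> opt j \<le> cost x"
  unfolding node_at_def using opt_le_path by blast

lemma sorted_nodes:
  "list_all2 node_at js xs \<Longrightarrow> sorted_wrt (<) js \<Longrightarrow> sorted_wrt prec xs"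
  by (auto simp: sorted_wrt_iff_nth_less list_all2_conv_all_nth node_at_def prec_def
      intro!: pre_mono[OF less_imp_le])

lemma sorted_cols: "sorted_wrt (<) js \<Longrightarrow> sorted_wrt prec (map colof js)"
  by (auto simp: sorted_wrt_iff_nth_less colof_def prec_def intro!: pre_mono[OF less_imp_le])

section \<open>Discarded rows, guesses and challengers\<close>

lemma w_monge: "i \<le> i' \<Longrightarrow> j \<le> j' \<Longrightarrow> w i j + w i' j' \<le> w i j' + w i' j"
proof -
  assume "i \<le> i'" "j \<le> j'"
  then have "0 \<le> (real j' - real j) * (pre i' - pre i) + (real i' - real i) * (pre j' - pre j)"
    by (intro add_nonneg_nonneg mult_nonneg_nonneg) (auto simp: pre_mono)
  then show ?thesis by (simp add: w_def algebra_simps)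
qed

text \<open>The licence to forget the nodes before \<open>r\<close>, needed only for the columns
  still open.\<close>

definition candidates :: "nat \<Rightarrow> nat \<Rightarrow> bool" where
  "candidates r c \<longleftrightarrow> (\<forall>j>c. \<forall>i'<r. \<exists>i\<in>{r..c}. opt i + w i j \<le> opt i' + w i' j)"

text \<open>Possibly not optimal, because starts after \<open>c\<close> have not been
  considered.\<close>

definition tentative :: "nat \<Rightarrow> nat \<Rightarrow> nat \<Rightarrow> node \<Rightarrow> bool" where
  "tentative r c j x \<longleftrightarrow> node_at j x \<and> (\<forall>i\<in>{r..c}. cost x \<le> opt i + w i j + C)"

text \<open>Tentative nodes beyond \<open>j\<close> may serve as rows for column \<open>j\<close>: the penalty \<open>C\<close> keeps their
  entries above the optimum, so they never win the comparison against an exact value.\<close>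

lemma challenger:
  assumes nodes: "list_all2 (tentative r c) [Suc c..<Suc p] xs"
    and exact: "\<And>i x. i \<in> {c<..<j} \<Longrightarrow> x \<in> set xs \<Longrightarrow> node_at i x \<Longrightarrow> exact i x"
    and cand: "candidates r c" and j: "c < j" "j \<le> p"
    and x: "tentative r c j x"
    and h: "minimizes (set xs) h (colof j)" and y: "y = link C h (colof j)"
  shows "\<not> cost y < cost x \<Longrightarrow> exact j x"
    and "cost y < cost x \<Longrightarrow> exact j y \<and> candidates (Suc c) j"
proof -
  have nth: "\<exists>z\<in>set xs. tentative r c i z" if "i \<in> {c<..p}" for i
    using nodes that unfolding list_all2_conv_all_nth
    by (metis (no_types, lifting) Suc_leI add_diff_inverse_nat diff_less_mono greaterThanAtMost_iff
        le_imp_less_Suc length_upt less_Suc_eq_le not_less nth_mem nth_upt)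
  obtain i where i: "i \<in> {c<..p}" "tentative r c i h"
    using nodes h unfolding minimizes_def list_all2_conv_all_nth in_set_conv_nth
    by (metis (no_types, lifting) Suc_le_eq add_diff_inverse_nat greaterThanAtMost_iff le_add1
        length_upt less_Suc_eq_le less_diff_conv2 nat_less_le not_less nth_upt add.commute less_diff_conv)
  have yi: "cost y = cost h + w i j + C"
    using cost_link[of i h j] i(2) y by (simp add: tentative_def)
  \<comment> \<open>An optimal start \<open>k\<close> for \<open>j\<close> was discarded (and
    \<open>candidates\<close> offers a substitute), or is a known row; both are covered by
    \<open>x\<close>. Otherwise it lies in the block before \<open>j\<close>, where nodes are exact,
    and is covered by \<open>y\<close>.\<close>
  have min_le: "min (cost x) (cost y) \<le> opt j"
  proof -
    obtain k where k: "k < j" "opt j = opt k + w k j + C"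
      using opt_attained[of j] j by auto
    consider "k < r" | "k \<in> {r..c}" | "c < k" by force
    then show ?thesis
    proof cases
      case 1
      then obtain k' where "k' \<in> {r..c}" "opt k' + w k' j \<le> opt k + w k j"
        using cand j unfolding candidates_def by blast
      then show ?thesis using x k(2) unfolding tentative_def by fastforce
    next
      case 2
      then show ?thesis using x k(2) unfolding tentative_def by fastforce
    next
      case 3
      then obtain z where z: "z \<in> set xs" "node_at k z"
        using nth[of k] k j unfolding tentative_def by auto
      then have "cost z = opt k" using exact[of k z] 3 k by (auto simp: exact_def)
      moreover have "cost h + w i j \<le> cost z + w k j"
        using h z i(2) entry_colof[of i h j] entry_colof[of k z j]
        by (auto simp: minimizes_def tentative_def)
      ultimately show ?thesis using yi k(2) by linarith
    qed
  qed
  have x_ge: "opt j \<le> cost x" using x opt_le_cost by (simp add: tentative_def)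
  show "exact j x" if "\<not> cost y < cost x"
    using that min_le x_ge x by (simp add: exact_def tentative_def)
  show "exact j y \<and> candidates (Suc c) j" if less: "cost y < cost x"
  proof -
    have y_le: "cost y \<le> opt j" using less min_le by simp
    have "i < j"
    proof (rule ccontr)
      assume "\<not> i < j"
      then have "opt j \<le> opt i" by (simp add: opt_mono)
      moreover have "opt i \<le> cost h" using i(2) opt_le_cost by (simp add: tentative_def)
      ultimately show False using y_le yi w_nonneg[of i j] C_pos by linarith
    qed
    have "node_at j y" using y node_at_link[of i h j] i(2) \<open>i < j\<close> by (simp add: tentative_def)
    then have y_ex: "exact j y" using y_le opt_le_cost[of j y] by (simp add: exact_def)
    have "cost h = opt i"
      using exact[of i h] i \<open>i < j\<close> h by (auto simp: minimizes_def tentative_def exact_def)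
    \<comment> \<open>The start \<open>i\<close> beats the known rows at \<open>j\<close> and lies
      to the right of all of them, so the Monge inequality keeps it ahead at later columns.\<close>
    have beats: "opt i + w i j' \<le> opt k + w k j'" if "k \<in> {r..c}" "j < j'" for k j'
    proof -
      have "opt i + w i j \<le> opt k + w k j"
        using x that(1) less yi \<open>cost h = opt i\<close> unfolding tentative_def by fastforce
      moreover have "w k j + w i j' \<le> w k j' + w i j"
        using w_monge[of k i j j'] that i(1) by simp
      ultimately show ?thesis by linarith
    qed
    have "candidates (Suc c) j"
      unfolding candidates_def
    proof (intro allI impI)
      fix j' k assume jk: "j < j'" "k < Suc c"
      have "i \<in> {Suc c..j}" using i(1) \<open>i < j\<close> by auto
      moreover have "opt i + w i j' \<le> opt k + w k j'"
      proof (cases "k < r")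
        case True
        then obtain k' where "k' \<in> {r..c}" "opt k' + w k' j' \<le> opt k + w k j'"
          using cand j jk unfolding candidates_def by (meson less_trans)
        then show ?thesis using beats[of k' j'] jk by linarith
      qed (use beats[of k j'] jk in auto)
      ultimately show "\<exists>i\<in>{Suc c..j}. opt i + w i j' \<le> opt k + w k j'" by blast
    qed
    then show ?thesis using y_ex by simp
  qed
qed

lemma node_at_unique: "node_at i x \<Longrightarrow> node_at j x \<Longrightarrow> i = j"
  by (simp add: node_at_def)

text \<open>Generalized to the middle of the pass, at column \<open>j\<close>: the accumulator is
  exact, while the challengers refer to all of \<open>zs\<close>, including its unverified part. The
  final disjunction feeds the amortization in \<open>lws_returns\<close>.\<close>

lemma check_correct:
  assumes "list_all2 exact [r..<Suc c] rows" "r \<le> c" "candidates r c" "c < p" "p \<le> n"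
    and nodes: "list_all2 (tentative r c) [Suc c..<Suc p] zs"
    and "c < j" "j \<le> Suc p"
    and "list_all2 exact [Suc c..<j] (rev acc)" "zs = rev acc @ xs"
    and "list_all2 (\<lambda>k y. \<exists>h. y = link C h (colof k) \<and> minimizes (set zs) h (colof k))
           [j..<Suc p] ys"
    and "check rows xs ys (map colof [j..<Suc n]) acc = (rows', cs')"
  shows "\<exists>r' c'. list_all2 exact [r'..<Suc c'] rows' \<and> r' \<le> c' \<and> candidates r' c' \<and>
    cs' = map colof [Suc c'..<Suc n] \<and> c' \<le> n \<and> c < c' \<and>
    (r' = r \<and> c' = p \<or> r' = Suc c \<and> c' \<le> p)"
  using assms(7-)
proof (induction "Suc p - j" arbitrary: j acc xs ys)
  case 0
  note prems = "0.prems"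
  then have j: "j = Suc p" using "0.hyps" by simp
  have "length zs = p - c" using list_all2_lengthD[OF nodes] by (simp del: upt_Suc)
  moreover have "length acc = p - c" using list_all2_lengthD[OF prems(3)] j by (simp del: upt_Suc)
  ultimately have "xs = []" using prems(4) by simp
  then have res: "rows' = rows @ rev acc" "cs' = map colof [j..<Suc n]"
    using prems(6) by auto
  show ?case
  proof -
    have "[r..<Suc p] = [r..<Suc c] @ [Suc c..<Suc p]"
      using assms(2,4) upt_add_eq_append[of r "Suc c" "p - c"] by (simp del: upt_Suc)
    then have "list_all2 exact [r..<Suc p] rows'"
      unfolding res using assms(1) prems(3) j by (simp add: list_all2_appendI del: upt_Suc)
    moreover have "candidates r p"
      unfolding candidates_def
    proof (intro allI impI)
      fix j' i' assume "p < j'" "i' < r"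
      then obtain i where "i \<in> {r..c}" "opt i + w i j' \<le> opt i' + w i' j'"
        using assms(3,4) unfolding candidates_def by (meson less_trans)
      then show "\<exists>i\<in>{r..p}. opt i + w i j' \<le> opt i' + w i' j'"
        using assms(4) by (intro bexI[of _ i]) auto
    qed
    ultimately show ?thesis
      using res j assms(2,4,5) by (intro exI[of _ r] exI[of _ p]) (auto simp del: upt_Suc)
  qed
next
  case (Suc d)
  note prems = Suc.prems
  have "j \<le> p" "j \<le> n" using Suc.hyps(2) assms(5) by auto
  have upt: "[j..<Suc p] = j # [Suc j..<Suc p]" "[j..<Suc n] = j # [Suc j..<Suc n]"
    using \<open>j \<le> p\<close> \<open>j \<le> n\<close> by (subst upt_conv_Cons; simp)+
  have "[Suc c..<Suc p] = [Suc c..<j] @ [j..<Suc p]"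
    using prems(1) \<open>j \<le> p\<close> upt_add_eq_append[of "Suc c" j "Suc p - j"] by simp
  moreover have "length (rev acc) = length [Suc c..<j]"
    using list_all2_lengthD[OF prems(3)] by simp
  ultimately have split: "list_all2 (tentative r c) [Suc c..<j] (rev acc)"
    "list_all2 (tentative r c) [j..<Suc p] xs"
    using nodes prems(4) by (simp_all add: list_all2_append del: upt_Suc)
  obtain x xs1 where xs: "xs = x # xs1" "tentative r c j x"
    using split(2) unfolding upt by (cases xs) auto
  obtain y ys1 h where ys: "ys = y # ys1" "y = link C h (colof j)" "minimizes (set zs) h (colof j)"
    "list_all2 (\<lambda>k y. \<exists>h. y = link C h (colof k) \<and> minimizes (set zs) h (colof k))
       [Suc j..<Suc p] ys1"
    using prems(5) unfolding upt by (cases ys) auto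
  \<comment> \<open>A node determines its position, so a node of \<open>zs\<close> at a position
    before \<open>j\<close> cannot come from the unverified part.\<close>
  have ex: "exact i z" if "i \<in> {c<..<j}" "z \<in> set zs" "node_at i z" for i z
  proof (cases "z \<in> set acc")
    case True
    then obtain k where "exact k z"
      using prems(3) by (metis in_set_conv_nth list_all2_conv_all_nth set_rev)
    then show ?thesis using that(3) node_at_unique[of k z i] by (auto simp: exact_def)
  next
    case False
    then have "z \<in> set xs" using that(2) prems(4) by simp
    then obtain k where "k \<in> set [j..<Suc p]" "tentative r c k z"
      using split(2) by (metis in_set_conv_nth list_all2_conv_all_nth)
    then show ?thesis using that node_at_unique[of k z i] by (auto simp: tentative_def)
  qed
  have ch: "\<not> cost y < cost x \<Longrightarrow> exact j x"
    "cost y < cost x \<Longrightarrow> exact j y \<and> candidates (Suc c) j"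
    using challenger[OF nodes _ assms(3) prems(1) \<open>j \<le> p\<close> xs(2) ys(3,2)] ex by blast+
  show ?case
  proof (cases "cost y < cost x")
    case True
    then have "rows' = rev acc @ [y]" "cs' = map colof [Suc j..<Suc n]"
      using prems(6) unfolding xs(1) ys(1) upt by auto
    moreover have "[Suc c..<Suc j] = [Suc c..<j] @ [j]" using prems(1) by simp
    ultimately show ?thesis
      using ch(2)[OF True] prems(1,3) \<open>j \<le> p\<close> \<open>j \<le> n\<close>
      by (intro exI[of _ "Suc c"] exI[of _ j]) (auto simp: list_all2_appendI simp del: upt_Suc)
  next
    case False
    have "check rows xs1 ys1 (map colof [Suc j..<Suc n]) (x # acc) = (rows', cs')"
      using prems(6) False unfolding xs(1) ys(1) upt by simp
    moreover have "list_all2 exact [Suc c..<Suc j] (rev (x # acc))"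
      using ch(1)[OF False] prems(1,3) by (simp add: list_all2_appendI)
    moreover have "d = Suc p - Suc j" using Suc.hyps(2) by simp
    moreover have "zs = rev (x # acc) @ xs1" using prems(4) xs(1) by simp
    ultimately show ?thesis
      using Suc.hyps(1)[of "Suc j" "x # acc" xs1 ys1] prems(1) \<open>j \<le> p\<close> ys(4) by simp
  qed
qed

section \<open>Whole rounds and their amortized cost\<close>

lemma sorted_exact:
  "list_all2 exact js xs \<Longrightarrow> sorted_wrt (<) js \<Longrightarrow> sorted_wrt prec xs"
  by (rule sorted_nodes) (auto elim: list_all2_mono simp: exact_def)

lemma tentative_links:
  assumes rows: "list_all2 exact [r..<Suc c] rows"
    and rs: "list_all2 (minimizes (set rows)) rs (map colof [Suc c..<Suc p])"
  shows "list_all2 (tentative r c) [Suc c..<Suc p] (map2 (link C) rs (map colof [Suc c..<Suc p]))"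
  unfolding list_all2_conv_all_nth
proof (intro conjI allI impI)
  have len: "length rs = p - c" using list_all2_lengthD[OF rs] by (simp del: upt_Suc)
  then show "length [Suc c..<Suc p] = length (map2 (link C) rs (map colof [Suc c..<Suc p]))"
    by (simp del: upt_Suc)
  fix k assume "k < length [Suc c..<Suc p]"
  then have k: "k < p - c" by (simp del: upt_Suc)
  define j where "j = Suc c + k"
  have nth: "[Suc c..<Suc p] ! k = j" using k by (simp add: j_def del: upt_Suc)
  have mini: "minimizes (set rows) (rs ! k) (colof j)"
    using rs k len nth by (auto simp: list_all2_conv_all_nth simp del: upt_Suc)
  have rows_nth: "rows ! (i - r) \<in> set rows" "exact i (rows ! (i - r))" if "i \<in> {r..c}" for i
  proof -
    have "i - r < length rows" using list_all2_lengthD[OF rows] that by auto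
    moreover from this have "exact ([r..<Suc c] ! (i - r)) (rows ! (i - r))"
      using rows by (auto simp: list_all2_conv_all_nth simp del: upt_Suc)
    ultimately show "rows ! (i - r) \<in> set rows" "exact i (rows ! (i - r))"
      using that by (auto simp del: upt_Suc)
  qed
  obtain i where i: "i \<in> set [r..<Suc c]" "exact i (rs ! k)"
    using mini rows unfolding minimizes_def
    by (metis in_set_conv_nth list_all2_conv_all_nth)
  have ent: "entry (rs ! k) (colof j) \<le> opt i' + w i' j" if "i' \<in> {r..c}" for i'
    using mini rows_nth[OF that] entry_colof[of i' "rows ! (i' - r)" j]
    by (auto simp: minimizes_def exact_def)
  have "tentative r c j (link C (rs ! k) (colof j))"
    unfolding tentative_def
  proof (intro conjI ballI)
    show "node_at j (link C (rs ! k) (colof j))"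
      using i by (intro node_at_link[of i]) (auto simp: exact_def j_def)
    fix i' assume "i' \<in> {r..c}"
    then show "cost (link C (rs ! k) (colof j)) \<le> opt i' + w i' j + C"
      using ent[of i'] by (simp add: link_def)
  qed
  then show "tentative r c ([Suc c..<Suc p] ! k)
      (map2 (link C) rs (map colof [Suc c..<Suc p]) ! k)"
    using k len nth by (simp del: upt_Suc)
qed

text \<open>The potential \<open>2\<rho> + 3\<kappa>\<close>, for \<open>\<rho>\<close> rows and \<open>\<kappa>\<close> remaining columns, drops by at least
  \<open>\<rho>\<close> in every round but the last: either \<open>\<rho>\<close> columns are finished, or all \<open>\<rho>\<close> rows are discarded.\<close>

lemma lws_returns:
  assumes "list_all2 exact [r..<Suc c] rows" "r \<le> c" "c \<le> n" "candidates r c"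
  shows "\<exists>x. returns (prog m) lws_fn
      [enc_list enc_node rows, enc_list enc_col (map colof [Suc c..<Suc n]), VNum C] (enc_node x)
      (7000 * (if c = n then Suc c - r else 2 * (Suc c - r) + 3 * (n - c))) \<and> exact n x"
  using assms
proof (induction "n - c" arbitrary: r c rows rule: less_induct)
  case less
  note prems = less.prems
  have len: "length rows = Suc c - r" using list_all2_lengthD[OF prems(1)] by (simp del: upt_Suc)
  show ?case
  proof (cases "c = n")
    case True
    have "[r..<Suc c] = [r..<c] @ [c]" using prems(2) by simp
    then obtain ys x where "rows = ys @ [x]" "exact c x"
      using prems(1) by (auto simp: list_all2_append1 list_all2_Cons1 simp del: upt_Suc)
    moreover from this(1) have "returns (prog m) lws_fn [enc_list enc_node rows, VNil, VNum C]
        (enc_node x) (7000 * (Suc c - r))"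
      unfolding returns_def wp_call_prog
      apply (simp add: lws_body_def)
      apply (rule wp_call_returns[OF rev_returns[of m enc_node "ys @ [x]", simplified]])
      using len apply simp
      done
    ultimately show ?thesis using True by (intro exI[of _ x]) auto
  next
    case False
    then have "c < n" using prems(3) by simp
    \<comment> \<open>The block has as many columns as there are rows, unless the columns run out;
      thus both matrices have size linear in the number of rows.\<close>
    define p where "p = c + min (Suc c - r) (n - c)"
    have p: "c < p" "p \<le> n" using \<open>c < n\<close> prems(2) by (auto simp: p_def)
    let ?cs = "map colof [Suc c..<Suc n]"
    define S where "S = map colof [Suc c..<Suc p]"
    have take: "take (length rows) ?cs = S"
    proof -
      have "take (length rows) [Suc c..<Suc n] = [Suc c..<Suc p]"
        using len prems(2) \<open>c < n\<close>
        by (intro nth_equalityI) (auto simp: p_def min_def simp del: upt_Suc)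
      then show ?thesis by (simp add: take_map S_def)
    qed
    have sortedS: "sorted_wrt prec S" unfolding S_def by (intro sorted_cols sorted_wrt_upt)
    have "rows \<noteq> []" "sorted_wrt prec rows"
      using len prems(2) sorted_exact[OF prems(1) sorted_wrt_upt] by auto
    from smawk_returns[OF this sortedS, of m] obtain rs where rs:
      "returns (prog m) smawk_fn [enc_list enc_node rows, enc_list enc_col S]
         (enc_list enc_node rs) (400 * length rows + 2200 * length S + 100)"
      "list_all2 (minimizes (set rows)) rs S" by blast
    define xs where "xs = map2 (link C) rs S"
    have xs: "list_all2 (tentative r c) [Suc c..<Suc p] xs"
      unfolding xs_def S_def by (rule tentative_links[OF prems(1) rs(2)[unfolded S_def]])
    have len_xs: "length xs = p - c" using list_all2_lengthD[OF xs] by (simp del: upt_Suc)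
    have "list_all2 node_at [Suc c..<Suc p] xs"
      using xs by (rule list_all2_mono) (simp add: tentative_def)
    then have "sorted_wrt prec xs" by (rule sorted_nodes) (rule sorted_wrt_upt)
    moreover have "xs \<noteq> []" using len_xs p by auto
    ultimately obtain hs where hs:
      "returns (prog m) smawk_fn [enc_list enc_node xs, enc_list enc_col S]
         (enc_list enc_node hs) (400 * length xs + 2200 * length S + 100)"
      "list_all2 (minimizes (set xs)) hs S"
      using smawk_returns[OF _ _ sortedS, of xs m] by blast
    define ys where "ys = map2 (link C) hs S"
    have len_hs: "length hs = p - c" using list_all2_lengthD[OF hs(2)] by (simp add: S_def del: upt_Suc)
    have ys: "list_all2 (\<lambda>k y. \<exists>h. y = link C h (colof k) \<and> minimizes (set xs) h (colof k))
       [Suc c..<Suc p] ys"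
      using hs(2) len_hs unfolding ys_def S_def
      by (auto simp: list_all2_conv_all_nth simp del: upt_Suc split_paired_Ex)
    obtain rows' cs' where chk: "check rows xs ys ?cs [] = (rows', cs')" by force
    obtain r' c' where new: "list_all2 exact [r'..<Suc c'] rows'" "r' \<le> c'" "candidates r' c'"
      "cs' = map colof [Suc c'..<Suc n]" "c' \<le> n" "c < c'"
      "r' = r \<and> c' = p \<or> r' = Suc c \<and> c' \<le> p"
      using check_correct[OF prems(1,2,4) p xs, of "Suc c" "[]" xs ys rows' cs'] ys chk p
      by (auto simp del: upt_Suc)
    obtain x where x: "returns (prog m) lws_fn
      [enc_list enc_node rows', enc_list enc_col cs', VNum C] (enc_node x)
      (7000 * (if c' = n then Suc c' - r' else 2 * (Suc c' - r') + 3 * (n - c')))" "exact n x"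
    proof -
      have "n - c' < n - c" using new(6) \<open>c < n\<close> by simp
      from less.hyps[OF this new(1,2,5,3)] show thesis using that unfolding new(4) by blast
    qed
    have "length ys = length xs" using len_hs len_xs by (simp add: ys_def S_def del: upt_Suc)
    moreover have "length xs \<le> length ?cs" using len_xs p by simp
    ultimately have chk_ret: "returns (prog m) check_fn
      [enc_list enc_node rows, enc_list enc_node xs, enc_list enc_node ys, enc_list enc_col ?cs,
        VNil]
      (VCons (enc_list enc_node rows') (enc_list enc_col cs'))
      (100 * (length rows + 2 * length xs) + 100)"
      using check_returns[of ys xs ?cs m rows "[]"] unfolding chk by (simp del: upt_Suc)
    \<comment> \<open>A round costs at most 6200 per row: 5200 for the two SMAWK calls, the
      remainder for links, check, prefix and constants. The drop of the potential pays 7000 per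
      row.\<close>
    have bnd: "6200 * (Suc c - r) +
        7000 * (if c' = n then Suc c' - r' else 2 * (Suc c' - r') + 3 * (n - c'))
      \<le> 7000 * (2 * (Suc c - r) + 3 * (n - c))"
    proof -
      obtain e d f where "c = r + e" "n = c + d" "c' = c + f"
        using prems(2) \<open>c < n\<close> new(6) by (metis le_Suc_ex less_imp_le)
      then show ?thesis
        using new(2,5,6,7) p by (auto simp: p_def min_def split: if_splits)
    qed
    obtain c1 cs1 where cs: "?cs = c1 # cs1" using \<open>c < n\<close> by (cases ?cs) (auto simp del: upt_Suc)
    have sp: "length xs \<le> Suc c - r" "length rows = Suc c - r" "1 \<le> Suc c - r"
      "length S = length xs"
      using len_xs len prems(2) by (auto simp: p_def S_def)
    have "returns (prog m) lws_fn [enc_list enc_node rows, enc_list enc_col ?cs, VNum C]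
      (enc_node x) (7000 * (2 * (Suc c - r) + 3 * (n - c)))"
      unfolding returns_def wp_call_prog
      apply (simp add: lws_body_def cs del: upt_Suc)
      apply (rule wp_call_returns[OF prefix_returns[of m rows ?cs, unfolded take, unfolded cs, simplified]])
      apply (rule wp_call_returns[OF rs(1)])
      apply (rule wp_call_returns[OF links_returns[of m rs S C, folded xs_def]])
      apply (rule wp_call_returns[OF hs(1)])
      apply (rule wp_call_returns[OF links_returns[of m hs S C, folded ys_def]])
      apply (rule wp_call_returns[OF chk_ret[unfolded cs, simplified]])
      apply (simp del: upt_Suc)
      apply (rule wp_call_returns[OF x(1)])
      using bnd sp apply (simp del: upt_Suc)
      done
    then show ?thesis using x(2) False by (intro exI[of _ x]) (simp del: upt_Suc)
  qed
qed

end


section \<open>Contiguous layerings suffice\<close>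

text \<open>The multiplier of each item's area, when consecutive layers have the given sizes.\<close>

definition weights :: "nat list \<Rightarrow> nat list" where
  "weights gs = concat (map (\<lambda>g. replicate g g) gs)"

lemma length_weights: "length (weights gs) = sum_list gs"
  by (induction gs) (auto simp: weights_def)

lemma set_weights: "set (weights gs) \<subseteq> set gs"
  by (auto simp: weights_def)

lemma weights_snoc: "weights (gs @ [g]) = weights gs @ replicate g g"
  by (simp add: weights_def)

lemma sum_weights_snoc:
  fixes x :: "nat \<Rightarrow> real"
  shows "(\<Sum>t<sum_list gs + g. real (weights (gs @ [g]) ! t) * x t) =
    (\<Sum>t<sum_list gs. real (weights gs ! t) * x t) +
    real g * (\<Sum>t\<in>{sum_list gs..<sum_list gs + g}. x t)"
proof -
  have "(\<Sum>t<sum_list gs + g. real (weights (gs @ [g]) ! t) * x t) =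
    (\<Sum>t<sum_list gs. real (weights (gs @ [g]) ! t) * x t) +
    (\<Sum>t\<in>{sum_list gs..<sum_list gs + g}. real (weights (gs @ [g]) ! t) * x t)"
    using sum.atLeastLessThan_concat[of 0 "sum_list gs" "sum_list gs + g"
        "\<lambda>t. real (weights (gs @ [g]) ! t) * x t"]
    by (simp add: lessThan_atLeast0)
  moreover have "(\<Sum>t<sum_list gs. real (weights (gs @ [g]) ! t) * x t) =
    (\<Sum>t<sum_list gs. real (weights gs ! t) * x t)"
    by (intro sum.cong) (auto simp: weights_snoc nth_append length_weights)
  moreover have "(\<Sum>t\<in>{sum_list gs..<sum_list gs + g}. real (weights (gs @ [g]) ! t) * x t) =
    real g * (\<Sum>t\<in>{sum_list gs..<sum_list gs + g}. x t)"
    unfolding sum_distrib_left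
    by (intro sum.cong) (auto simp: weights_snoc nth_append length_weights)
  ultimately show ?thesis by simp
qed

text \<open>Deleting entries of a sorted list only lets later, hence no smaller, ones move
  up.\<close>

lemma sorted_nth_le_filter:
  "sorted (map f xs) \<Longrightarrow> t < length (filter P xs) \<Longrightarrow> f (xs ! t) \<le> f (filter P xs ! t)"
proof (induction xs arbitrary: t)
  case (Cons x xs)
  show ?case
  proof (cases "P x")
    case True
    then show ?thesis using Cons by (cases t) auto
  next
    case False
    have "t < length (filter P xs)" using Cons.prems(2) False by simp
    moreover from this have "t < length xs" by (meson length_filter_le less_le_trans)
    moreover from this have "f ((x # xs) ! t) \<le> f (xs ! t)"
      using Cons.prems(1) sorted_nth_mono[of "map f (x # xs)" t "Suc t"]
      by (simp del: list.map(2) add: nth_map)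
    ultimately show ?thesis using Cons.IH[of t] Cons.prems(1) False by simp
  qed
qed simp

lemma sum_set_nth: "distinct us \<Longrightarrow> (\<Sum>i\<in>set us. f i) = (\<Sum>t<length us. f (us ! t))"
  by (simp add: sum_list_distinct_conv_sum_set[symmetric] sum_list_sum_nth lessThan_atLeast0)

text \<open>Removing a smallest layer (of size \<open>s\<close>) shifts the remaining sorted areas upwards. All
  weights being at least \<open>s\<close>, the shift pays for giving the weight \<open>s\<close> to the largest areas.\<close>

lemma contiguous_le_partition:
  fixes a :: "nat \<Rightarrow> real"
  assumes "partition_on (set us) Q" "distinct us" "sorted (map a us)"
  shows "\<exists>gs. sum_list gs = length us \<and> length gs = card Q \<and> set gs \<subseteq> card ` Q \<and>
    (\<Sum>t<length us. real (weights gs ! t) * a (us ! t)) \<le> (\<Sum>S\<in>Q. real (card S) * (\<Sum>i\<in>S. a i))"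
proof -
  have "finite Q" using assms(1) finite_elements by blast
  then show ?thesis
    using assms
  proof (induction "card Q" arbitrary: Q us)
    case 0
    then have "Q = {}" by simp
    then have "us = []" using "0.prems" by (simp add: partition_on_def)
    then show ?case using \<open>Q = {}\<close> by simp
  next
    case (Suc k)
    note prems = Suc.prems
    have "Q \<noteq> {}" using Suc.hyps(2) by auto
    define s where "s = Min (card ` Q)"
    have "s \<in> card ` Q" using prems(1) \<open>Q \<noteq> {}\<close> unfolding s_def by (intro Min_in) auto
    then obtain S where S: "S \<in> Q" "s = card S" by auto
    have s_min: "s \<le> card T" if "T \<in> Q" for T
      using prems(1) that unfolding s_def by (intro Min_le) auto
    define vs where "vs = filter (\<lambda>i. i \<notin> S) us"
    have sub: "S \<subseteq> set us" "finite S" "S \<noteq> {}"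
      using prems(2) S(1) by (auto simp: partition_on_def intro: finite_subset)
    have set_vs: "set vs = set us - S" by (auto simp: vs_def)
    have part: "partition_on (set vs) (Q - {S})"
      unfolding set_vs partition_on_def
    proof (intro conjI)
      show "\<Union> (Q - {S}) = set us - S"
        using prems(2) S(1) by (auto simp: partition_on_def disjoint_def)
      show "disjoint (Q - {S})" using prems(2) by (auto simp: partition_on_def disjoint_def)
      show "{} \<notin> Q - {S}" using prems(2) by (auto simp: partition_on_def)
    qed
    have "distinct vs" "sorted (map a vs)"
      using prems(3,4) by (auto simp: vs_def intro: sorted_filter)
    moreover have "k = card (Q - {S})" using Suc.hyps(2) prems(1) S(1) by simp
    ultimately obtain gs where gs: "sum_list gs = length vs" "length gs = card (Q - {S})"
      "set gs \<subseteq> card ` (Q - {S})"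
      "(\<Sum>t<length vs. real (weights gs ! t) * a (vs ! t))
        \<le> (\<Sum>T\<in>Q - {S}. real (card T) * (\<Sum>i\<in>T. a i))"
      using Suc.hyps(1)[of "Q - {S}" vs] part prems(1) by blast
    define l where "l = length vs"
    define wt where "wt t = real (weights gs ! t)" for t
    define x where "x t = a (us ! t)" for t
    define y where "y t = a (vs ! t)" for t
    have len: "length us = l + s"
    proof -
      have "card (set us) = card (set us - S) + card S"
        using sub by (metis List.finite_set card_Diff_subset card_mono le_add_diff_inverse2)
      then show ?thesis
        using prems(3) \<open>distinct vs\<close> S(2) by (simp add: set_vs[symmetric] distinct_card l_def)
    qed
    have xy: "x t \<le> y t" if "t < l" for t
      using sorted_nth_le_filter[of a us t] prems(4) that
      by (simp add: x_def y_def vs_def l_def)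
    \<comment> \<open>Each weight is the size of a remaining layer; this is why the induction
      records where the sizes \<open>gs\<close> come from.\<close>
    have wt: "real s \<le> wt t" if "t < l" for t
    proof -
      have "weights gs ! t \<in> set (weights gs)" using that gs(1) by (simp add: length_weights l_def)
      then have "weights gs ! t \<in> card ` (Q - {S})" using set_weights gs(3) by blast
      then show ?thesis using s_min by (auto simp: wt_def)
    qed
    have sum_us: "(\<Sum>t<l. x t) + (\<Sum>t\<in>{l..<l + s}. x t) = (\<Sum>t<l. y t) + (\<Sum>i\<in>S. a i)"
    proof -
      have "(\<Sum>i\<in>set us. a i) = (\<Sum>i\<in>set vs. a i) + (\<Sum>i\<in>S. a i)"
        unfolding set_vs using sub by (metis List.finite_set sum.subset_diff)
      moreover have "(\<Sum>i\<in>set us. a i) = (\<Sum>t<l + s. x t)"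
        using sum_set_nth[OF prems(3), of a] len by (simp add: x_def)
      moreover have "(\<Sum>i\<in>set vs. a i) = (\<Sum>t<l. y t)"
        using sum_set_nth[OF \<open>distinct vs\<close>, of a] by (simp add: y_def l_def)
      moreover have "(\<Sum>t<l + s. x t) = (\<Sum>t<l. x t) + (\<Sum>t\<in>{l..<l + s}. x t)"
        using sum.atLeastLessThan_concat[of 0 l "l + s" x] by (simp add: lessThan_atLeast0)
      ultimately show ?thesis by simp
    qed
    have "(\<Sum>t<l. real s * (y t - x t)) \<le> (\<Sum>t<l. wt t * (y t - x t))"
      using xy wt by (intro sum_mono mult_right_mono) auto
    then have shift: "real s * ((\<Sum>t<l. y t) - (\<Sum>t<l. x t)) \<le> (\<Sum>t<l. wt t * y t) - (\<Sum>t<l. wt t * x t)"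
      by (simp add: right_diff_distrib sum_subtractf sum_distrib_left)
    have "(\<Sum>t<length us. real (weights (gs @ [s]) ! t) * a (us ! t)) =
        (\<Sum>t<l. wt t * x t) + real s * (\<Sum>t\<in>{l..<l + s}. x t)"
      using sum_weights_snoc[of gs s x] gs(1) len by (simp add: l_def wt_def x_def)
    also have "\<dots> \<le> (\<Sum>t<l. wt t * y t) + real s * (\<Sum>i\<in>S. a i)"
    proof -
      have "(\<Sum>t\<in>{l..<l + s}. x t) = (\<Sum>t<l. y t) - (\<Sum>t<l. x t) + (\<Sum>i\<in>S. a i)"
        using sum_us by simp
      then show ?thesis using shift by (simp add: distrib_left)
    qed
    also have "\<dots> \<le> (\<Sum>T\<in>Q - {S}. real (card T) * (\<Sum>i\<in>T. a i)) + real s * (\<Sum>i\<in>S. a i)"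
      using gs(4) by (simp add: l_def wt_def y_def)
    also have "\<dots> = (\<Sum>T\<in>Q. real (card T) * (\<Sum>i\<in>T. a i))"
      using prems(1) S by (simp add: sum.remove)
    finally have "(\<Sum>t<length us. real (weights (gs @ [s]) ! t) * a (us ! t))
      \<le> (\<Sum>T\<in>Q. real (card T) * (\<Sum>i\<in>T. a i))" .
    moreover have "sum_list (gs @ [s]) = length us" using gs(1) len by (simp add: l_def)
    moreover have "length (gs @ [s]) = card Q"
      using gs(2) prems(1) S(1) Suc.hyps(2) by simp
    moreover have "set (gs @ [s]) \<subseteq> card ` Q" using gs(3) S by auto
    ultimately show ?case by blast
  qed
qed


section \<open>Solving sorted instances\<close>

context items
begin

text \<open>Sizes \<open>gs\<close> describe a contiguous layering, whose last layer is split off by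
  \<open>opt_le\<close>. The shift \<open>Suc t\<close> reconciles list indices from 0 with
  positions from 1.\<close>

lemma opt_le_weights:
  assumes "\<forall>g\<in>set gs. 0 < g"
  shows "opt (sum_list gs) \<le>
    (\<Sum>t<sum_list gs. real (weights gs ! t) * a (lab (Suc t))) + C * real (length gs)"
  using assms
proof (induction gs rule: rev_induct)
  case (snoc g gs)
  define l where "l = sum_list gs"
  have "opt (l + g) \<le> opt l + w l (l + g) + C"
    using snoc.prems by (intro opt_le) simp
  moreover have "w l (l + g) = real g * (\<Sum>t\<in>{l..<l + g}. a (lab (Suc t)))"
  proof -
    have "pre (l + g) = pre l + (\<Sum>k\<in>{Suc l..<Suc (l + g)}. a (lab k))"
      unfolding pre_def using sum.ub_add_nat[of 1 l "\<lambda>k. a (lab k)" g]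
      by (simp add: atLeastLessThanSuc_atLeastAtMost)
    then show ?thesis unfolding w_def sum.atLeast_Suc_lessThan_Suc_shift by (simp add: comp_def)
  qed
  moreover have "opt l \<le> (\<Sum>t<l. real (weights gs ! t) * a (lab (Suc t))) + C * real (length gs)"
    using snoc by (simp add: l_def)
  ultimately have "opt (l + g) \<le> (\<Sum>t<l. real (weights gs ! t) * a (lab (Suc t))) +
      real g * (\<Sum>t\<in>{l..<l + g}. a (lab (Suc t))) + C * real (length (gs @ [g]))"
    by (simp add: distrib_left)
  then show ?case
    using sum_weights_snoc[of gs g "\<lambda>t. a (lab (Suc t))"] by (simp add: l_def)
qed (simp add: weights_def)

text \<open>A cut is the last position of the preceding layer, so the test with \<open>+ 1\<close>
  recognizes the layer's first item \<open>Suc i\<close>, and the layer is closed together with it.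
  Hence no empty layer arises.\<close>

lemma emit_segment:
  assumes "i < k"
    and rest: "returns (prog m) emit_fn
      [enc_list VNum b, enc_list enc_col (rev (map colof [1..<Suc i])), VNil] v T"
  shows "returns (prog m) emit_fn
    [VCons (VNum (real i)) (enc_list VNum b), enc_list enc_col (rev (map colof [1..<Suc k])),
     enc_list (\<lambda>u. VNum (real u)) cur]
    (VCons (enc_list (\<lambda>u. VNum (real u)) (map lab [Suc i..<Suc k] @ cur)) v) (T + 50 * (k - i))"
  using assms(1)
proof (induction k arbitrary: cur)
  case (Suc k)
  define cs where "cs = rev (map colof [1..<Suc k])"
  have cs: "rev (map colof [1..<Suc (Suc k)]) = colof (Suc k) # cs" by (simp add: cs_def)
  show ?case
  proof (cases "i = k")
    case True
    then show ?thesis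
      using rest unfolding cs
      unfolding returns_def wp_call_prog cs_def[symmetric]
      apply (simp add: emit_body_def)
      apply (simp add: colof_def cs_def[symmetric])
      apply (rule wp_call_returns[OF rest[unfolded True, folded cs_def]])
      apply simp
      done
  next
    case False
    then have "i < k" using Suc.prems by simp
    define M where "M = map lab [Suc i..<Suc k]"
    have upt: "map lab [Suc i..<Suc (Suc k)] @ cur = M @ lab (Suc k) # cur"
      using \<open>i < k\<close> by (simp add: M_def)
    note IH = Suc.IH[OF \<open>i < k\<close>, of "lab (Suc k) # cur", folded cs_def M_def]
    show ?thesis
      unfolding cs upt returns_def wp_call_prog
      using \<open>i < k\<close>
      apply (simp add: emit_body_def colof_def)
      apply (rule wp_call_returns[OF IH[unfolded list.map val_of_list.simps]])
      apply simp
      done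
  qed
qed simp

text \<open>Layers come out from the last one backwards, each internally in increasing order; hence
  \<open>rev\<close> on the outer list only.\<close>

lemma emit_returns:
  assumes "path j F b"
  shows "\<exists>Ls. returns (prog m) emit_fn
      [enc_list VNum b, enc_list enc_col (rev (map colof [1..<Suc j])), VNil]
      (enc_list (enc_list (\<lambda>u. VNum (real u))) Ls) (50 * j + 50) \<and>
    concat (rev Ls) = map lab [1..<Suc j] \<and> [] \<notin> set Ls \<and>
    F = (\<Sum>L\<leftarrow>Ls. real (length L) * (\<Sum>u\<leftarrow>L. a u) + C)"
  using assms
proof (induction rule: path.induct)
  case path_0
  then show ?case
    unfolding returns_def wp_call_prog by (intro exI[of _ "[]"]) (simp add: emit_body_def)
next
  case (path_step i F b j)
  then obtain Ls where Ls: "returns (prog m) emit_fn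
      [enc_list VNum b, enc_list enc_col (rev (map colof [1..<Suc i])), VNil]
      (enc_list (enc_list (\<lambda>u. VNum (real u))) Ls) (50 * i + 50)"
    "concat (rev Ls) = map lab [1..<Suc i]" "[] \<notin> set Ls"
    "F = (\<Sum>L\<leftarrow>Ls. real (length L) * (\<Sum>u\<leftarrow>L. a u) + C)" by blast
  let ?L = "map lab [Suc i..<Suc j]"
  have time: "50 * i + 50 + 50 * (j - i) = 50 * j + 50" using path_step(2) by simp
  have "returns (prog m) emit_fn
      [enc_list VNum (real i # b), enc_list enc_col (rev (map colof [1..<Suc j])), VNil]
      (enc_list (enc_list (\<lambda>u. VNum (real u))) (?L # Ls)) (50 * j + 50)"
    using emit_segment[OF path_step(2) Ls(1), of "[]"] unfolding time by (simp del: upt_Suc)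
  moreover have upt: "[1..<Suc j] = [1..<Suc i] @ [Suc i..<Suc j]"
    using path_step(2) upt_add_eq_append[of 1 "Suc i" "j - i"] by simp
  then have "concat (rev (?L # Ls)) = map lab [1..<Suc j]" using Ls(2) by (simp del: upt_Suc)
  moreover have "[] \<notin> set (?L # Ls)" using Ls(3) path_step(2) by (simp del: upt_Suc)
  moreover have "w i j = real (length ?L) * (\<Sum>u\<leftarrow>?L. a u)"
  proof -
    have "pre j = pre i + (\<Sum>k\<in>{Suc i..<Suc j}. a (lab k))"
      unfolding pre_def using path_step(2) sum.ub_add_nat[of 1 i "\<lambda>k. a (lab k)" "j - i"]
      by (simp add: atLeastLessThanSuc_atLeastAtMost)
    then show ?thesis
      using path_step(2)
      by (simp add: w_def of_nat_diff comp_def interv_sum_list_conv_sum_set_nat del: upt_Suc)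
  qed
  then have "F + w i j + C = (\<Sum>L\<leftarrow>?L # Ls. real (length L) * (\<Sum>u\<leftarrow>L. a u) + C)"
    using Ls(4) by (simp del: upt_Suc)
  ultimately show ?case by blast
qed

lemma columns_eq:
  assumes "\<forall>i<length us. us ! i = lab (Suc (k + i))"
  shows "columns a us (real k) (pre k) = map colof [Suc k..<Suc (k + length us)]"
  using assms
proof (induction us arbitrary: k)
  case (Cons u us)
  have u: "u = lab (Suc k)" using Cons.prems by auto
  have "pre (Suc k) = pre k + a u" by (simp add: pre_def u)
  moreover have "\<forall>i<length us. us ! i = lab (Suc (Suc k + i))" using Cons.prems by force
  then have "columns a us (real (Suc k)) (pre (Suc k)) =
      map colof [Suc (Suc k)..<Suc (Suc k + length us)]" by (rule Cons.IH)
  moreover have "[Suc k..<Suc (k + length (u # us))] =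
      Suc k # [Suc (Suc k)..<Suc (Suc k + length us)]"
    by (subst upt_conv_Cons) auto
  ultimately show ?case by (simp add: colof_def u add.commute del: upt_Suc)
qed simp

end

lemma perimeter_sum_penalized:
  assumes "instance_ok n L1 L2 a" "partition_on {1..n} Q"
  shows "perimeter_sum L1 a Q =
    2 / L1 * (\<Sum>S\<in>Q. real (card S) * (\<Sum>i\<in>S. a i) + L1 * L1)"
proof -
  have "0 < L1" using assms(1) by (simp add: instance_ok_def)
  then have "c * (1 / L1 * A) + L1 = (c * A + L1 * L1) / L1" for c A
    by (simp add: field_simps)
  then have "(\<Sum>S\<in>Q. real (card S) * layer_height L1 a S + L1) =
    (\<Sum>S\<in>Q. real (card S) * (\<Sum>i\<in>S. a i) + L1 * L1) / L1"
    unfolding sum_divide_distrib layer_height_def by (simp only:)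
  then show ?thesis unfolding perimeter_sum_alt[OF assms] by simp
qed

lemma solve_returns:
  assumes ok: "instance_ok n L1 L2 a"
    and us: "distinct us" "set us = {1..n}" "sorted (map a us)"
  shows "\<exists>v P. returns (prog m) solve_fn [VNum L1, enc_list (enc_item a) us] v (40000 * n) \<and>
    represents v P \<and> optimal_layering n L1 a P"
proof -
  \<comment> \<open>Clamping the index keeps \<open>lab j\<close> among the items for every
    \<open>j\<close>, as the locale requires; positions count from 1.\<close>
  define lab where "lab j = us ! min (j - 1) (n - 1)" for j
  have n: "1 \<le> n" and L1: "0 < L1" and a_pos: "\<forall>i\<in>{1..n}. 0 < a i"
    using ok by (auto simp: instance_ok_def)
  have len: "length us = n" using us(1,2) distinct_card[of us] by simp
  have lab_in: "lab j \<in> {1..n}" for j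
    unfolding lab_def us(2)[symmetric] using n len by (intro nth_mem) simp
  interpret items a lab "L1 * L1"
    using lab_in a_pos L1 by unfold_locales (auto intro: less_imp_le)
  have us_lab: "us ! i = lab (Suc i)" if "i < n" for i
    using that by (simp add: lab_def)
  have cols: "columns a us 0 0 = map colof [1..<Suc n]"
    using columns_eq[of us 0] us_lab len by (simp add: pre_def del: upt_Suc)
  have map_lab: "map lab [1..<Suc n] = us"
    by (rule nth_equalityI) (auto simp: len us_lab simp del: upt_Suc)
  define z where "z = (0::real, 0::real, 0::real, [] :: real list)"
  have "exact 0 z" using path_0 by (simp add: exact_def node_at_def z_def pre_def)
  then obtain x where x: "returns (prog m) lws_fn
      [enc_list enc_node [z], enc_list enc_col (map colof [1..<Suc n]), VNum (L1 * L1)]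
      (enc_node x) (7000 * (2 + 3 * n))" "exact n x"
    using lws_returns[of 0 0 "[z]" n m] n by (auto simp: candidates_def)
  then obtain Ls where Ls: "returns (prog m) emit_fn
      [enc_list VNum (cuts x), enc_list enc_col (rev (map colof [1..<Suc n])), VNil]
      (enc_list (enc_list (\<lambda>u. VNum (real u))) Ls) (50 * n + 50)"
    "concat (rev Ls) = us" "[] \<notin> set Ls"
    "opt n = (\<Sum>L\<leftarrow>Ls. real (length L) * (\<Sum>u\<leftarrow>L. a u) + L1 * L1)"
    using emit_returns[of n "cost x" "cuts x" m] map_lab by (auto simp: exact_def node_at_def)
  define cs where "cs = map colof [1..<Suc n]"
  have z: "VCons (VNum 0) (VCons (VNum 0) (VCons (VNum 0) VNil)) = enc_node z"
    by (simp add: z_def enc_node_def)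
  \<comment> \<open>The search contributes \<open>21000 * n + 14000\<close>, one row and
    \<open>n\<close> columns being the start; \<open>1 \<le> n\<close> absorbs all
    constants.\<close>
  have ret: "returns (prog m) solve_fn [VNum L1, enc_list (enc_item a) us]
      (enc_list (enc_list (\<lambda>u. VNum (real u))) Ls) (40000 * n)"
    unfolding returns_def wp_call_prog
    apply (simp add: solve_body_def)
    apply (rule wp_call_returns[OF columns_returns[of m a us 0 0, unfolded cols, folded cs_def]])
    apply (simp add: z)
    apply (rule wp_call_returns[OF x(1)[folded cs_def, simplified]])
    apply simp
    apply (rule wp_call_returns[OF rev_returns])
    apply (rule wp_call_returns[OF Ls(1)[folded cs_def]])
    using n len apply (simp add: cs_def del: upt_Suc)
    done
  define P where "P = set (map set Ls)"
  have "distinct (concat (rev Ls))" using us(1) Ls(2) by simp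
  then have dist: "distinct Ls" "\<And>L. L \<in> set Ls \<Longrightarrow> distinct L"
    "\<And>L M. L \<in> set Ls \<Longrightarrow> M \<in> set Ls \<Longrightarrow> L \<noteq> M \<Longrightarrow> set L \<inter> set M = {}"
    using Ls(3) by (auto simp: distinct_concat_iff removeAll_id)
  \<comment> \<open>Different layers with equal sets would be disjoint from each other, hence
    empty.\<close>
  have "inj_on set (set Ls)"
    using dist(3) Ls(3) by (metis inf.idem inj_onI set_empty)
  then have dist_P: "distinct (map set Ls)" using dist(1) by (simp add: distinct_map)
  have part: "partition_on {1..n} P"
    unfolding partition_on_def disjoint_def
  proof (intro conjI ballI impI)
    have "set (concat (rev Ls)) = {1..n}" by (simp only: Ls(2) us(2))
    then show "\<Union> P = {1..n}" by (simp add: P_def)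
    show "{} \<notin> P" using Ls(3) by (auto simp: P_def)
    fix S T assume "S \<in> P" "T \<in> P" "S \<noteq> T"
    then show "S \<inter> T = {}" using dist(3) by (auto simp: P_def)
  qed
  have "(\<Sum>S\<in>P. real (card S) * (\<Sum>i\<in>S. a i) + L1 * L1) = opt n"
  proof -
    have "real (card (set L)) * (\<Sum>i\<in>set L. a i) = real (length L) * (\<Sum>u\<leftarrow>L. a u)"
      if "L \<in> set Ls" for L
      using dist(2)[OF that] by (simp add: distinct_card sum_list_distinct_conv_sum_set)
    then show ?thesis
      unfolding P_def Ls(4) sum.distinct_set_conv_list[OF dist_P]
      by (simp add: comp_def cong: map_cong)
  qed
  then have cost_P: "perimeter_sum L1 a P = 2 / L1 * opt n"
    using perimeter_sum_penalized[OF ok part] by simp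
  have "perimeter_sum L1 a P \<le> perimeter_sum L1 a Q" if Q: "partition_on {1..n} Q" for Q
  proof -
    obtain gs where gs: "sum_list gs = n" "length gs = card Q" "set gs \<subseteq> card ` Q"
      "(\<Sum>t<n. real (weights gs ! t) * a (us ! t)) \<le> (\<Sum>S\<in>Q. real (card S) * (\<Sum>i\<in>S. a i))"
      using contiguous_le_partition[of us Q a] us Q len by auto
    have "0 < card S" if "S \<in> Q" for S
      using Q that by (auto simp: partition_on_def card_gt_0_iff intro: finite_subset)
    then have "\<forall>g\<in>set gs. 0 < g" using gs(3) by auto
    from opt_le_weights[OF this] have "opt n \<le>
      (\<Sum>t<n. real (weights gs ! t) * a (lab (Suc t))) + L1 * L1 * real (card Q)"
      using gs(1,2) by simp
    also have "(\<Sum>t<n. real (weights gs ! t) * a (lab (Suc t))) =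
        (\<Sum>t<n. real (weights gs ! t) * a (us ! t))"
      by (simp add: us_lab)
    finally have "opt n \<le> (\<Sum>S\<in>Q. real (card S) * (\<Sum>i\<in>S. a i) + L1 * L1)"
      using gs(4) by (simp add: sum.distrib mult.commute)
    then show ?thesis
      unfolding cost_P perimeter_sum_penalized[OF ok Q] using L1 by (intro mult_left_mono) auto
  qed
  then have "optimal_layering n L1 a P" using part by (simp add: optimal_layering_def)
  moreover have "represents (enc_list (enc_list (\<lambda>u. VNum (real u))) Ls) P"
    unfolding represents_def using dist_P dist(2) P_def by blast
  ultimately show ?thesis using ret by blast
qed


section \<open>Running times\<close>

definition main_unsorted :: expr where
  "main_unsorted = Call solve_fn [Var 0, Call msort_fn [Call labels_fn [Var 2, Lit 1]]]"

text \<open>The areas are in increasing order unless the last one is smaller than the first.\<close>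

definition main_sorted :: expr where
  "main_sorted = LetIn (Call labels_fn [Var 2, Lit 1]) (LetIn (Call revapp_fn [Var 0, EmptyList])
     (Call solve_fn
       [Var 2, IfLess (Tl (Hd (Var 0))) (Tl (Hd (Var 1))) (Var 0) (Var 1)]))"

text \<open>Rewriting with \<open>main_unsorted_def\<close> directly would also expand the name
  inside \<open>prog main_unsorted\<close>, and the \<open>returns\<close> facts would no longer
  match.\<close>

lemma wp_main_unsorted:
  "wp p env main_unsorted Q \<longleftrightarrow>
     wp p env (Call solve_fn [Var 0, Call msort_fn [Call labels_fn [Var 2, Lit 1]]]) Q"
  by (simp only: main_unsorted_def)

lemma wp_main_sorted:
  "wp p env main_sorted Q \<longleftrightarrow>
     wp p env (LetIn (Call labels_fn [Var 2, Lit 1]) (LetIn (Call revapp_fn [Var 0, EmptyList])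
       (Call solve_fn
         [Var 2, IfLess (Tl (Hd (Var 0))) (Tl (Hd (Var 1))) (Var 0) (Var 1)]))) Q"
  by (simp only: main_sorted_def)

lemma wp_call_main: "wp_call (prog m) 0 vs Q \<longleftrightarrow> wp (prog m) vs m Q"
  by (simp add: wp_call_def prog_def)

lemma runs_returns:
  assumes "returns (prog m) 0 input v N"
  shows "\<exists>t. runs (prog m) input v t \<and> t \<le> N"
  using assms unfolding returns_def wp_call_main wp_def runs_def by (auto simp: prog_def)

section \<open>Asymptotics and the two programs\<close>

lemma ex_power_ge:
  assumes "1 \<le> n"
  obtains k :: nat where "n \<le> 2 ^ k" "real k \<le> log 2 (real n) + 1"
proof
  have log: "0 \<le> log 2 (real n)" using assms by simp
  let ?k = "nat \<lceil>log 2 (real n)\<rceil>"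
  have "real n = 2 powr (log 2 (real n))" using assms by simp
  also have "\<dots> \<le> 2 powr (real ?k)" by (intro powr_mono) linarith+
  finally have "real n \<le> 2 ^ ?k" by (simp add: powr_realpow)
  then show "n \<le> 2 ^ ?k" by (metis of_nat_le_iff of_nat_numeral of_nat_power)
  show "real ?k \<le> log 2 (real n) + 1" using log by linarith
qed

text \<open>From \<open>n = 3\<close> on \<open>ln n\<close> is at least 1, and \<open>ln 2\<close>
  is at least 1/2; so \<open>log 2 n + 2\<close> is at most \<open>4 * ln n\<close>, and 41200 is
  200 * 4 + 40400.\<close>

lemma unsorted_bigo:
  "(\<lambda>n. 200 * (real n * (log 2 (real n) + 2)) + 40400 * real n) \<in> O(\<lambda>n. real n * ln (real n))"
proof (rule bigoI[where c = 41200], unfold eventually_sequentially, intro exI[of _ 3] allI impI)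
  fix n :: nat assume n: "3 \<le> n"
  have "exp 1 \<le> real n" using exp_le n by linarith
  then have ln_n: "1 \<le> ln (real n)" using n by (simp add: ln_ge_iff)
  have "1 \<le> ln (4::real)" using exp_le by (subst ln_ge_iff) auto
  also have "ln (4::real) = 2 * ln 2" using ln_realpow[of 2 2] by simp
  finally have "1 / 2 \<le> ln (2::real)" by simp
  then have "ln (real n) / ln 2 \<le> ln (real n) / (1 / 2)"
    using ln_n by (intro divide_left_mono) auto
  then have "log 2 (real n) + 2 \<le> 4 * ln (real n)" using ln_n by (simp add: log_def)
  then have "real n * (log 2 (real n) + 2) \<le> real n * (4 * ln (real n))"
    by (intro mult_left_mono) auto
  moreover have "real n * 1 \<le> real n * ln (real n)" using ln_n by (intro mult_left_mono) auto
  moreover have "0 \<le> log 2 (real n)" using n by simp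
  ultimately show "norm (200 * (real n * (log 2 (real n) + 2)) + 40400 * real n)
      \<le> 41200 * norm (real n * ln (real n))"
    using ln_n by (simp add: abs_mult)
qed

lemma solves_unsorted:
  "solves_within (prog main_unsorted) (\<lambda>n a. True)
     (\<lambda>n. 200 * (real n * (log 2 (real n) + 2)) + 40400 * real n)"
  unfolding solves_within_def
proof (intro allI impI)
  fix n L1 L2 a
  assume "instance_ok n L1 L2 a \<and> True"
  then have ok: "instance_ok n L1 L2 a" by simp
  then have n: "1 \<le> n" by (simp add: instance_ok_def)
  obtain k where k: "n \<le> 2 ^ k" "real k \<le> log 2 (real n) + 1" using ex_power_ge[OF n] .
  obtain us where us: "returns (prog main_unsorted) msort_fn [enc_list (enc_item a) [1..<Suc n]]
      (enc_list (enc_item a) us) (200 * (k + 1) * n + 10)"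
    "mset us = mset [1..<Suc n]" "sorted (map a us)"
    using msort_returns[of "[1..<Suc n]" k main_unsorted a] k(1)
    by (simp only: length_upt diff_Suc_1) blast
  have "distinct us" "set us = {1..n}"
    using mset_eq_imp_distinct_iff[OF us(2)] mset_eq_setD[OF us(2)]
    by (simp_all only: distinct_upt set_upt atLeastLessThanSuc_atLeastAtMost)
  from solve_returns[OF ok this us(3), of main_unsorted] obtain v P where v:
    "returns (prog main_unsorted) solve_fn [VNum L1, enc_list (enc_item a) us] v (40000 * n)"
    "represents v P" "optimal_layering n L1 a P" by blast
  have lab: "returns (prog main_unsorted) (Suc 0)
      [enc_list (\<lambda>i. VNum (a i)) [1..<Suc n], VNum 1]
      (enc_list (enc_item a) [1..<Suc n]) (100 * n + 100)"
    using labels_returns[of main_unsorted a 1 n] by (simp del: upt_Suc)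
  have "returns (prog main_unsorted) 0 (encode_input n L1 L2 a) v
      (200 * (k + 1) * n + 40400 * n)"
    unfolding returns_def wp_call_main wp_main_unsorted encode_input_def
    apply (simp del: upt_Suc)
    apply (rule wp_call_returns[OF lab[unfolded One_nat_def]])
    apply (rule wp_call_returns[OF us(1)[unfolded One_nat_def]])
    apply (rule wp_call_returns[OF v(1)])
    using n apply simp
    done
  then obtain t where t: "runs (prog main_unsorted) (encode_input n L1 L2 a) v t"
    "t \<le> 200 * (k + 1) * n + 40400 * n" using runs_returns by blast
  have "real t \<le> real (200 * (k + 1) * n + 40400 * n)" using t(2) by (simp only: of_nat_le_iff)
  also have "\<dots> = 200 * (real n * (real k + 1)) + 40400 * real n" by (simp add: algebra_simps)
  also have "\<dots> \<le> 200 * (real n * (log 2 (real n) + 2)) + 40400 * real n"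
    using k(2) by (intro add_right_mono mult_left_mono) auto
  finally show "\<exists>v t P. runs (prog main_unsorted) (encode_input n L1 L2 a) v t \<and>
      real t \<le> 200 * (real n * (log 2 (real n) + 2)) + 40400 * real n \<and>
      represents v P \<and> optimal_layering n L1 a P" using t(1) v by blast
qed

lemma solves_sorted:
  "solves_within (prog main_sorted) (\<lambda>n a. mono_on {1..n} a \<or> antimono_on {1..n} a)
     (\<lambda>n. 41000 * real n)"
  unfolding solves_within_def
proof (intro allI impI)
  fix n L1 L2 a
  assume asm: "instance_ok n L1 L2 a \<and> (mono_on {1..n} a \<or> antimono_on {1..n} a)"
  then have ok: "instance_ok n L1 L2 a" by simp
  then have n: "1 \<le> n" by (simp add: instance_ok_def)
  define ls where "ls = [1..<Suc n]"
  have ls: "distinct ls" "set ls = {1..n}" "length ls = n" by (auto simp: ls_def)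
  have ends: "ls = 1 # tl ls" "rev ls = n # tl (rev ls)"
    using n by (simp_all add: ls_def upt_conv_Cons del: upt_Suc) (simp add: upt_Suc)
  define us where "us = (if a n < a 1 then rev ls else ls)"
  have us: "distinct us" "set us = {1..n}" using ls by (auto simp: us_def)
  have sorted_us: "sorted (map a us)"
  proof -
    have nth: "ls ! i = Suc i" if "i < n" for i
      using that by (simp add: ls_def del: upt_Suc)
    show ?thesis
    proof (cases "a n < a 1")
      case True
      then have "\<not> mono_on {1..n} a" using n by (auto dest: mono_onD[of _ _ 1 n])
      then have "antimono_on {1..n} a" using asm by simp
      then have "a (Suc j) \<le> a (Suc i)" if "i \<le> j" "j < n" for i j
        using that by (auto simp: monotone_on_def)
      then have "sorted (rev (map a ls))"
        by (auto simp: sorted_rev_iff_nth_mono nth ls(3))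
      then show ?thesis using True by (simp add: us_def rev_map)
    next
      case False
      have "a (Suc i) \<le> a (Suc j)" if ij: "i \<le> j" "j < n" for i j
      proof (cases "mono_on {1..n} a")
        case True
        then show ?thesis using ij by (auto simp: monotone_on_def)
      next
        case False
        then have anti: "antimono_on {1..n} a" using asm by simp
        \<comment> \<open>A non-increasing sequence whose last entry is not below its first is
          constant.\<close>
        have "a (Suc i) \<le> a 1" "a n \<le> a (Suc j)"
          using anti ij by (auto simp: monotone_on_def)
        then show ?thesis using \<open>\<not> a n < a 1\<close> by linarith
      qed
      then have "sorted (map a ls)" by (auto simp: sorted_iff_nth_mono nth ls(3))
      then show ?thesis using False by (simp add: us_def)
    qed
  qed
  from solve_returns[OF ok us sorted_us, of main_sorted] obtain v P where v:
    "returns (prog main_sorted) solve_fn [VNum L1, enc_list (enc_item a) us] v (40000 * n)"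
    "represents v P" "optimal_layering n L1 a P" by blast
  have lab: "returns (prog main_sorted) (Suc 0)
      [enc_list (\<lambda>i. VNum (a i)) ls, VNum 1] (enc_list (enc_item a) ls) (100 * n + 100)"
    using labels_returns[of main_sorted a 1 n] by (simp add: ls_def del: upt_Suc)
  have enc: "enc_list (enc_item a) ls = VCons (enc_item a 1) (enc_list (enc_item a) (tl ls))"
    "enc_list (enc_item a) (rev ls) = VCons (enc_item a n) (enc_list (enc_item a) (tl (rev ls)))"
     apply (subst ends(1), simp)
    apply (subst ends(2), simp)
    done
  have v': "a n < a 1 \<Longrightarrow> returns (prog main_sorted) solve_fn
      [VNum L1, VCons (enc_item a n) (enc_list (enc_item a) (tl (rev ls)))] v (40000 * n)"
    "\<not> a n < a 1 \<Longrightarrow> returns (prog main_sorted) solve_fn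
      [VNum L1, VCons (enc_item a 1) (enc_list (enc_item a) (tl ls))] v (40000 * n)"
    using v(1) by (simp_all only: us_def if_True if_False enc)
  have "returns (prog main_sorted) 0 (encode_input n L1 L2 a) v (41000 * n)"
    unfolding returns_def wp_call_main wp_main_sorted encode_input_def ls_def[symmetric]
    apply simp
    apply (rule wp_call_returns[OF lab])
    apply (rule wp_call_returns[OF rev_returns])
    apply (simp add: enc)
    apply (intro conjI impI)
     apply (rule wp_call_returns[OF v'(1)[unfolded One_nat_def]])
      apply assumption
    using n apply (simp add: ls)
    apply (rule wp_call_returns[OF v'(2)[unfolded One_nat_def]])
     apply assumption
    using n apply (simp add: ls)
    done
  then obtain t where t: "runs (prog main_sorted) (encode_input n L1 L2 a) v t" "t \<le> 41000 * n"
    using runs_returns by blast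
  from t(2) have "real t \<le> 41000 * real n" by linarith
  then show "\<exists>v t P. runs (prog main_sorted) (encode_input n L1 L2 a) v t \<and>
      real t \<le> 41000 * real n \<and> represents v P \<and> optimal_layering n L1 a P" using t(1) v by blast
qed

theorem mainTheorem1:
  shows "(\<exists>(p :: program) (T :: nat \<Rightarrow> real).
            T \<in> O(\<lambda>n. real n * ln (real n)) \<and> solves_within p (\<lambda>n a. True) T) \<and>
         (\<exists>(p :: program) (T :: nat \<Rightarrow> real).
            T \<in> O(\<lambda>n. real n) \<and>
            solves_within p (\<lambda>n a. mono_on {1..n} a \<or> antimono_on {1..n} a) T)"
proof -
  have "(\<lambda>n. 41000 * real n) \<in> O(\<lambda>n. real n)" by simp
  then show ?thesis using unsorted_bigo solves_unsorted solves_sorted by blast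
qed

end
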